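(* Let $\dot H$ be a densely defined closed prime symmetric operator in a separable complex Hilbert space $\mathcal H$, with deficiency indices $(k,k)$, $k\in\mathbb N\cup\{\infty\}$, and let $\mathcal N_+=\ker(\dot H^*-i)$. Let $H$ be a self-adjoint extension of $\dot H$ in $\mathcal H$ with strongly right-continuous family of orthogonal spectral projections $\{E_H(\lambda)\}_{\lambda\in\mathbb R}$, let $P_{\mathcal N_+}$ be the orthogonal projection onto $\mathcal N_+$, and let $$\Omega_{H,\mathcal N_+}(\lambda)=(1+\lambda^2)\bigl(P_{\mathcal N_+}E_H(\lambda)P_{\mathcal N_+}\big|_{\mathcal N_+}\bigr).$$ Let $\{u_{+,n}\}_{n\in\mathcal I}$, $\mathcal I\subseteq\mathbb N$, be a complete orthonormal system in $\mathcal N_+$ and let $\widetilde U:\widehat{\mathcal H}=L^2(\mathbb R,\mathcal N_+;d\Omega_{H,\mathcal N_+})\to\mathcal H$ be the unitary operator described in the context. Then the pair $(\dot H,H)$ is unitarily equivalent to the model pair $(\widehat{\dot H},\widehat H)$ (defined in the context), $$\dot H=\widetilde U\,\widehat{\dot H}\,\widetilde U^{-1},\qquad H=\widetilde U\,\widehat H\,\widetilde U^{-1}.$$ Moreover, $\widetilde U\widehat{\mathcal N}_+=\mathcal N_+$, where $$\widehat{\mathcal N}_+=\overline{\mathrm{lin.span}\{\underline{\underline u}_{+,n}\in\widehat{\mathcal H}\,|\,\underline{\underline u}_{+,n}(\lambda)=(\lambda-i)^{-1}u_{+,n},\ \lambda\in\mathbb R,\ n\in\mathcal I\}}.$$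
   Context: Scalar products are linear in the second factor; $\Sigma$ is the Borel $\sigma$-algebra on $\mathbb R$. Prime. For a densely defined closed symmetric operator $\dot H$ with deficiency indices $(k,k)$ put $\mathcal H_0=\overline{\mathrm{lin.span}\{(H-z)^{-1}u_+\,|\,u_+\in\ker(\dot H^*-i),\ z\in\mathbb C\setminus\mathbb R\}}$, where $H$ is a self-adjoint extension of $\dot H$ (the space $\mathcal H_0$ does not depend on the choice of $H$; all self-adjoint extensions of $\dot H$ are reduced by $\mathcal H_0$ and coincide on $\mathcal H_0^\perp$). $\dot H$ is called prime if $\mathcal H_0^\perp=\{0\}$. Model space. Write $\mathcal N=\mathcal N_+$, $u_n=u_{+,n}$, and let $\widetilde\Omega(B)=P_{\mathcal N}E_H(B)P_{\mathcal N}|_{\mathcal N}$, $B\in\Sigma$, with control measure $\tilde\mu$ ($\sigma$-finite, $\tilde\mu(B)=0$ iff $\widetilde\Omega(B)=0$; e.g. $\tilde\mu(B)=\sum_n2^{-n}(u_n,\widetilde\Omega(B)u_n)$). Put $\mathcal V=\mathrm{lin.span}\{u_n\}$ and let $\phi_{m,n}$ satisfy $\int_B\phi_{m,n}d\tilde\mu=(u_m,\widetilde\Omega(B)u_n)$. For $\tilde\mu$-a.e. $\lambda$, $(v,w)_\lambda=\sum_{m,n}\phi_{m,n}(\lambda)\overline{\alpha_m}\beta_n$ ($v=\sum\alpha_nu_n$, $w=\sum\beta_nu_n$) is a semi-inner product on $\mathcal V$; $\mathcal N_\lambda$ is the completion of $\mathcal V/\{v:(v,v)_\lambda=0\}$.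 For $v\in\mathcal V$, $\underline v=\{\underline v(\lambda)\}$ denotes the family with $\underline v(\lambda)$ the class of $v$ in $\mathcal N_\lambda$ (also written simply $v$). $\mathcal M$ is the set of all families $f=\{f(\lambda)\in\mathcal N_\lambda\}_{\lambda\in\mathbb R}$ with $\lambda\mapsto(\underline u_n(\lambda),f(\lambda))_{\mathcal N_\lambda}$ $\tilde\mu$-measurable for all $n$. $L^2(\mathbb R,\mathcal N;w\,d\widetilde\Omega)$ is the Hilbert space of ($\tilde\mu$-a.e. classes of) $f\in\mathcal M$ with $\int w\|f(\lambda)\|^2_{\mathcal N_\lambda}d\tilde\mu<\infty$. The map $v\mapsto\underline v$ extends by continuity to a bounded map $\underline\Lambda:\mathcal N\to L^2(\mathbb R,\mathcal N;d\widetilde\Omega)$, and we write $\underline\xi=\underline\Lambda\xi$. Since $d\Omega_{H,\mathcal N_+}=(1+\lambda^2)d\widetilde\Omega$, $L^2(\mathbb R,\mathcal N;w\,d\Omega_{H,\mathcal N_+})$ means $L^2(\mathbb R,\mathcal N;w(\lambda)(1+\lambda^2)\,d\widetilde\Omega)$. The operator $\widetilde U$. $\widetilde U:\widehat{\mathcal H}\to\mathcal H$ is the unitary operator which is the continuous linear extension of the map sending finite sums $\sum_{m,n}\alpha_{m,n}\chi_{B_m}\underline{\underline u}_{+,n}$ ($\alpha_{m,n}\in\mathbb C$, $B_m\in\Sigma$, $\underline{\underline u}_{+,n}(\lambda)=(\lambda-i)^{-1}\underline u_n(\lambda)$) to $\sum_{m,n}\alpha_{m,n}E_H(B_m)u_{+,n}$.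 Model operators. $(\widehat H\hat f)(\lambda)=\lambda\hat f(\lambda)$ with $\mathrm{dom}(\widehat H)=L^2(\mathbb R,\mathcal N;(1+\lambda^2)d\Omega_{H,\mathcal N_+})$, and $\widehat{\dot H}$ is the restriction of $\widehat H$ to $$\mathrm{dom}(\widehat{\dot H})=\Bigl\{\hat f\in\mathrm{dom}(\widehat H)\,\Big|\,\int_{\mathbb R}(1+\lambda^2)(\underline\xi(\lambda),\hat f(\lambda))_{\mathcal N_\lambda}d\tilde\mu(\lambda)=0\text{ for all }\xi\in\mathcal N\Bigr\}.$$ *)

theory Defs
  imports "HOL-Analysis.Analysis"
begin

text \<open>The inner product is linear in the second argument.  The underlying real
  inner product space structure supplies norm and topology.\<close>

class complex_hilbert_space = real_inner + complete_space +
  fixes scaleC :: "complex \<Rightarrow> 'a \<Rightarrow> 'a" (infixr "*\<^sub>C" 75)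
    and cinner :: "'a \<Rightarrow> 'a \<Rightarrow> complex"
  assumes scaleC_add_right: "a *\<^sub>C (x + y) = a *\<^sub>C x + a *\<^sub>C y"
    and scaleC_add_left: "(a + b) *\<^sub>C x = a *\<^sub>C x + b *\<^sub>C x"
    and scaleC_scaleC: "a *\<^sub>C (b *\<^sub>C x) = (a * b) *\<^sub>C x"
    and scaleR_scaleC: "r *\<^sub>R x = complex_of_real r *\<^sub>C x"
    and cinner_commute: "cinner x y = cnj (cinner y x)"
    and cinner_add_right: "cinner x (y + z) = cinner x y + cinner x z"
    and cinner_scaleC_right: "cinner x (c *\<^sub>C y) = c * cinner x y"
    and inner_eq_Re_cinner: "inner x y = Re (cinner x y)"

lemma vector_space_scaleC:
  "vector_space (scaleC :: complex \<Rightarrow> 'a \<Rightarrow> 'a::complex_hilbert_space)"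
  by unfold_locales
    (simp_all add: scaleC_add_right scaleC_add_left scaleC_scaleC
      scaleR_scaleC [of 1, simplified, symmetric])

abbreviation cspan :: "'a::complex_hilbert_space set \<Rightarrow> 'a set" where
  "cspan \<equiv> module.span scaleC"

text \<open>Complex dimension in \<open>\<nat> \<union> {\<infinity>}\<close>; infinite cardinals are not distinguished.\<close>

definition cdim :: "'a::complex_hilbert_space set \<Rightarrow> enat" where
  "cdim S = (SUP B\<in>{B. finite B \<and> B \<subseteq> S \<and> \<not> module.dependent scaleC B}. enat (card B))"

definition ortho :: "'a::complex_hilbert_space set \<Rightarrow> 'a set" where
  "ortho S = {x. \<forall>y\<in>S. cinner y x = 0}"

definition orth_proj :: "'a::complex_hilbert_space set \<Rightarrow> 'a \<Rightarrow> 'a" where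
  "orth_proj S x = (THE y. y \<in> S \<and> x - y \<in> ortho S)"

definition is_orth_projection :: "('a::complex_hilbert_space \<Rightarrow> 'a) \<Rightarrow> bool" where
  "is_orth_projection P \<longleftrightarrow>
     Vector_Spaces.linear scaleC scaleC P \<and> P \<circ> P = P \<and>
     (\<forall>x y. cinner (P x) y = cinner x (P y))"

definition complete_orthonormal_system ::
    "(nat \<Rightarrow> 'a::complex_hilbert_space) \<Rightarrow> nat set \<Rightarrow> 'a set \<Rightarrow> bool" where
  "complete_orthonormal_system u I S \<longleftrightarrow>
     (\<forall>m\<in>I. \<forall>n\<in>I. cinner (u m) (u n) = (if m = n then 1 else 0)) \<and>
     closure (cspan (u ` I)) = S"

text \<open>An operator \<open>T\<close> is identified with its graph: \<open>(x, y) \<in> T\<close> means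
  \<open>x \<in> dom T\<close> and \<open>T x = y\<close>.  Hence \<open>dom T\<close> is \<open>Domain T\<close>, extension of operators is
  inclusion, and an operator is closed iff its graph is closed in the product topology.\<close>

definition linear_operator :: "('a::complex_hilbert_space \<times> 'a) set \<Rightarrow> bool" where
  "linear_operator T \<longleftrightarrow>
     single_valued T \<and> (0, 0) \<in> T \<and>
     (\<forall>x y x' y'. (x, y) \<in> T \<longrightarrow> (x', y') \<in> T \<longrightarrow> (x + x', y + y') \<in> T) \<and>
     (\<forall>c x y. (x, y) \<in> T \<longrightarrow> (c *\<^sub>C x, c *\<^sub>C y) \<in> T)"

definition densely_defined :: "('a::complex_hilbert_space \<times> 'a) set \<Rightarrow> bool" where
  "densely_defined T \<longleftrightarrow> closure (Domain T) = UNIV"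

definition adjoint_op ::
    "('a::complex_hilbert_space \<times> 'a) set \<Rightarrow> ('a \<times> 'a) set" where
  "adjoint_op T = {(x, y). \<forall>(v, w)\<in>T. cinner x w = cinner y v}"

definition symmetric_op :: "('a::complex_hilbert_space \<times> 'a) set \<Rightarrow> bool" where
  "symmetric_op T \<longleftrightarrow> linear_operator T \<and> T \<subseteq> adjoint_op T"

definition self_adjoint_op :: "('a::complex_hilbert_space \<times> 'a) set \<Rightarrow> bool" where
  "self_adjoint_op T \<longleftrightarrow> linear_operator T \<and> densely_defined T \<and> T = adjoint_op T"

definition defect_space ::
    "('a::complex_hilbert_space \<times> 'a) set \<Rightarrow> complex \<Rightarrow> 'a set" where
  "defect_space T z = {x. (x, z *\<^sub>C x) \<in> adjoint_op T}"

definition deficiency_indices ::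
    "('a::complex_hilbert_space \<times> 'a) set \<Rightarrow> enat \<times> enat" where
  "deficiency_indices T = (cdim (defect_space T \<i>), cdim (defect_space T (- \<i>)))"

text \<open>\<open>x = (H - z)\<^sup>-\<^sup>1 v\<close> is expressed as \<open>(x, v + z x) \<in> H\<close>.\<close>

definition resolvent_hull ::
    "('a::complex_hilbert_space \<times> 'a) set \<Rightarrow> ('a \<times> 'a) set \<Rightarrow> 'a set" where
  "resolvent_hull T H =
     closure (cspan {x. \<exists>v z. v \<in> defect_space T \<i> \<and> Im z \<noteq> 0 \<and> (x, v + z *\<^sub>C x) \<in> H})"

text \<open>\<open>resolvent_hull T H\<close> is the same for all self-adjoint extensions \<open>H\<close> of \<open>T\<close>.  The
  notion is only meant for \<open>T\<close> with equal deficiency indices, where such \<open>H\<close> exist.\<close>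

definition prime_op :: "('a::complex_hilbert_space \<times> 'a) set \<Rightarrow> bool" where
  "prime_op T \<longleftrightarrow>
     (\<forall>H. self_adjoint_op H \<and> T \<subseteq> H \<longrightarrow> ortho (resolvent_hull T H) = {0})"

text \<open>\<open>A\<close> acts on a space \<open>'b\<close> and \<open>U\<close> is a bijection from that space onto \<open>'a\<close>:
  the graph of \<open>U A U\<^sup>-\<^sup>1\<close>.\<close>

definition conjugate_op :: "('b \<Rightarrow> 'a) \<Rightarrow> ('b \<times> 'b) set \<Rightarrow> ('a \<times> 'a) set" where
  "conjugate_op U A = {(U x, U y) | x y. (x, y) \<in> A}"

text \<open>\<open>F\<close> is the strongly right-continuous spectral family of the operator \<open>H\<close>, that is
  \<open>H = \<integral> t dF(t)\<close>: the domain of \<open>H\<close> consists of the \<open>x\<close> with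
  \<open>\<integral> t\<^sup>2 d\<parallel>F(t) x\<parallel>\<^sup>2 < \<infinity>\<close>, and \<open>(x, H x) = \<integral> t d(x, F(t) x)\<close> there, which
  determines \<open>H x\<close> by polarization.  Note \<open>(x, F(t) x) = \<parallel>F(t) x\<parallel>\<^sup>2\<close>.\<close>

definition spectral_family ::
    "('a::complex_hilbert_space \<times> 'a) set \<Rightarrow> (real \<Rightarrow> 'a \<Rightarrow> 'a) \<Rightarrow> bool" where
  "spectral_family H F \<longleftrightarrow>
     (\<forall>t. is_orth_projection (F t)) \<and>
     (\<forall>s t. s \<le> t \<longrightarrow> F s \<circ> F t = F s) \<and>
     (\<forall>x t. ((\<lambda>s. F s x) \<longlongrightarrow> F t x) (at_right t)) \<and>
     (\<forall>x. ((\<lambda>t. F t x) \<longlongrightarrow> 0) at_bot) \<and>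
     (\<forall>x. ((\<lambda>t. F t x) \<longlongrightarrow> x) at_top) \<and>
     Domain H = {x. integrable (interval_measure (\<lambda>t. (norm (F t x))\<^sup>2)) (\<lambda>t. t\<^sup>2)} \<and>
     (\<forall>(x, y)\<in>H. cinner x y =
        complex_of_real (LINT t|interval_measure (\<lambda>t. (norm (F t x))\<^sup>2). t))"

definition projection_valued_measure ::
    "(real set \<Rightarrow> 'a::complex_hilbert_space \<Rightarrow> 'a) \<Rightarrow> bool" where
  "projection_valued_measure E \<longleftrightarrow>
     (\<forall>B\<in>sets borel. is_orth_projection (E B)) \<and> E UNIV = id \<and>
     (\<forall>A\<in>sets borel. \<forall>B\<in>sets borel. E (A \<inter> B) = E A \<circ> E B) \<and>
     (\<forall>A :: nat \<Rightarrow> real set. range A \<subseteq> sets borel \<longrightarrow> disjoint_family A \<longrightarrow>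
        (\<forall>x. (\<lambda>n. E (A n) x) sums E (\<Union>n. A n) x))"

text \<open>The compression \<open>P\<^sub>N E(B) P\<^sub>N\<close>, to be used on \<open>N\<close> only.\<close>

definition compression ::
    "'a::complex_hilbert_space set \<Rightarrow> (real set \<Rightarrow> 'a \<Rightarrow> 'a) \<Rightarrow> real set \<Rightarrow> 'a \<Rightarrow> 'a" where
  "compression N E B x = orth_proj N (E B (orth_proj N x))"

definition control_measure ::
    "'a::complex_hilbert_space set \<Rightarrow> (real set \<Rightarrow> 'a \<Rightarrow> 'a) \<Rightarrow> real measure \<Rightarrow> bool" where
  "control_measure N E \<mu> \<longleftrightarrow>
     sets \<mu> = sets borel \<and> sigma_finite_measure \<mu> \<and>
     (\<forall>B\<in>sets borel. emeasure \<mu> B = 0 \<longleftrightarrow> (\<forall>x\<in>N. compression N E B x = 0))"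

definition density_matrix ::
    "'a::complex_hilbert_space set \<Rightarrow> (real set \<Rightarrow> 'a \<Rightarrow> 'a) \<Rightarrow> real measure \<Rightarrow>
     (nat \<Rightarrow> 'a) \<Rightarrow> nat set \<Rightarrow> (nat \<Rightarrow> nat \<Rightarrow> real \<Rightarrow> complex) \<Rightarrow> bool" where
  "density_matrix N E \<mu> u I \<phi> \<longleftrightarrow>
     (\<forall>m\<in>I. \<forall>n\<in>I. integrable \<mu> (\<phi> m n) \<and>
        (\<forall>B\<in>sets borel. (LINT t:B|\<mu>. \<phi> m n t) = cinner (u m) (compression N E B (u n))))"

text \<open>The form \<open>(v, w)\<^sub>t\<close> for \<open>v, w\<close> in the linear span of the orthonormal \<open>u n\<close>, whose
  coefficients are \<open>cinner (u n) v\<close>; both sums are finite there.\<close>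

definition fibre_form ::
    "(nat \<Rightarrow> 'a::complex_hilbert_space) \<Rightarrow> nat set \<Rightarrow> (nat \<Rightarrow> nat \<Rightarrow> real \<Rightarrow> complex) \<Rightarrow>
     real \<Rightarrow> 'a \<Rightarrow> 'a \<Rightarrow> complex" where
  "fibre_form u I \<phi> t v w =
     (\<Sum>m | m \<in> I \<and> cinner (u m) v \<noteq> 0. \<Sum>n | n \<in> I \<and> cinner (u n) w \<noteq> 0.
        \<phi> m n t * cnj (cinner (u m) v) * cinner (u n) w)"

text \<open>A completion of \<open>V / {v. (v, v)\<^sub>t = 0}\<close> is a Hilbert space with a linear map \<open>J t\<close> from
  \<open>V\<close> onto a dense subspace that carries \<open>(\<cdot>, \<cdot>)\<^sub>t\<close> to the inner product; \<open>J t v\<close> is the class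
  of \<open>v\<close>.  The completions for the various \<open>t\<close> are realised as closed subspaces
  \<open>fibre u I J t\<close> of one Hilbert space \<open>'k\<close>; as they are separable, this is no restriction, and
  no relation between different \<open>t\<close> is imposed.  The form is positive semidefinite, hence has
  a completion, only for almost every \<open>t\<close>; for the other \<open>t\<close> the fibre is arbitrary.\<close>

definition fibre_completions ::
    "(nat \<Rightarrow> 'a::complex_hilbert_space) \<Rightarrow> nat set \<Rightarrow> (nat \<Rightarrow> nat \<Rightarrow> real \<Rightarrow> complex) \<Rightarrow>
     real measure \<Rightarrow> (real \<Rightarrow> 'a \<Rightarrow> 'k::complex_hilbert_space) \<Rightarrow> bool" where
  "fibre_completions u I \<phi> \<mu> J \<longleftrightarrow>
     (\<forall>t. \<forall>v\<in>cspan (u ` I). \<forall>w\<in>cspan (u ` I). J t (v + w) = J t v + J t w) \<and>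
     (\<forall>t. \<forall>c. \<forall>v\<in>cspan (u ` I). J t (c *\<^sub>C v) = c *\<^sub>C J t v) \<and>
     (AE t in \<mu>. \<forall>v\<in>cspan (u ` I). \<forall>w\<in>cspan (u ` I).
        cinner (J t v) (J t w) = fibre_form u I \<phi> t v w)"

definition fibre ::
    "(nat \<Rightarrow> 'a::complex_hilbert_space) \<Rightarrow> nat set \<Rightarrow>
     (real \<Rightarrow> 'a \<Rightarrow> 'k::complex_hilbert_space) \<Rightarrow> real \<Rightarrow> 'k set" where
  "fibre u I J t = closure (J t ` cspan (u ` I))"

text \<open>The measurable families.  Measurability refers to the completion of \<open>\<mu>\<close>, so that it is
  insensitive to changes on null sets.\<close>

definition fields ::
    "(nat \<Rightarrow> 'a::complex_hilbert_space) \<Rightarrow> nat set \<Rightarrow>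
     (real \<Rightarrow> 'a \<Rightarrow> 'k::complex_hilbert_space) \<Rightarrow> real measure \<Rightarrow> (real \<Rightarrow> 'k) set" where
  "fields u I J \<mu> =
     {f. (\<forall>t. f t \<in> fibre u I J t) \<and>
         (\<forall>n\<in>I. (\<lambda>t. cinner (J t (u n)) (f t)) \<in> borel_measurable (completion \<mu>))}"

definition wnorm2 ::
    "real measure \<Rightarrow> (real \<Rightarrow> real) \<Rightarrow> (real \<Rightarrow> 'k::complex_hilbert_space) \<Rightarrow> ennreal" where
  "wnorm2 \<mu> w f = (\<integral>\<^sup>+ t. ennreal (w t * (norm (f t))\<^sup>2) \<partial>completion \<mu>)"

definition sq_fields ::
    "(nat \<Rightarrow> 'a::complex_hilbert_space) \<Rightarrow> nat set \<Rightarrow>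
     (real \<Rightarrow> 'a \<Rightarrow> 'k::complex_hilbert_space) \<Rightarrow> real measure \<Rightarrow> (real \<Rightarrow> real) \<Rightarrow>
     (real \<Rightarrow> 'k) set" where
  "sq_fields u I J \<mu> w = {f \<in> fields u I J \<mu>. wnorm2 \<mu> w f < \<infinity>}"

definition ae_class ::
    "(nat \<Rightarrow> 'a::complex_hilbert_space) \<Rightarrow> nat set \<Rightarrow>
     (real \<Rightarrow> 'a \<Rightarrow> 'k::complex_hilbert_space) \<Rightarrow> real measure \<Rightarrow> (real \<Rightarrow> 'k) \<Rightarrow>
     (real \<Rightarrow> 'k) set" where
  "ae_class u I J \<mu> f = {g \<in> fields u I J \<mu>. AE t in \<mu>. g t = f t}"

text \<open>\<open>L\<^sup>2(\<real>, \<N>; w d\<Omega>)\<close>, where \<open>d\<Omega>\<close> is the compressed spectral measure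
  \<open>P\<^sub>N E(\<cdot>) P\<^sub>N\<close>.  In terms of the measure \<open>(1 + t\<^sup>2) d\<Omega>\<close> of the operator, an
  additional weight factor \<open>1 + t\<^sup>2\<close> occurs.\<close>

definition L2_fields ::
    "(nat \<Rightarrow> 'a::complex_hilbert_space) \<Rightarrow> nat set \<Rightarrow>
     (real \<Rightarrow> 'a \<Rightarrow> 'k::complex_hilbert_space) \<Rightarrow> real measure \<Rightarrow> (real \<Rightarrow> real) \<Rightarrow>
     (real \<Rightarrow> 'k) set set" where
  "L2_fields u I J \<mu> w = ae_class u I J \<mu> ` sq_fields u I J \<mu> w"

text \<open>The class of \<open>\<Lambda> \<xi>\<close>, where \<open>\<Lambda>\<close> is the extension by continuity of the map taking
  \<open>v \<in> V\<close> to the class of \<open>\<lambda>t. J t v\<close>, with values in \<open>L\<^sup>2(\<real>, \<N>; d\<Omega>)\<close>.\<close>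

definition Lambda_ext ::
    "(nat \<Rightarrow> 'a::complex_hilbert_space) \<Rightarrow> nat set \<Rightarrow>
     (real \<Rightarrow> 'a \<Rightarrow> 'k::complex_hilbert_space) \<Rightarrow> real measure \<Rightarrow> 'a \<Rightarrow> (real \<Rightarrow> 'k) set" where
  "Lambda_ext u I J \<mu> \<xi> =
     {g \<in> sq_fields u I J \<mu> (\<lambda>_. 1). \<exists>v. range v \<subseteq> cspan (u ` I) \<and> v \<longlonglongrightarrow> \<xi> \<and>
        (\<lambda>j::nat. wnorm2 \<mu> (\<lambda>_. 1) (\<lambda>t. J t (v j) - g t)) \<longlonglongrightarrow> 0}"

definition L2_unitary ::
    "(nat \<Rightarrow> 'a::complex_hilbert_space) \<Rightarrow> nat set \<Rightarrow>
     (real \<Rightarrow> 'a \<Rightarrow> 'k::complex_hilbert_space) \<Rightarrow> real measure \<Rightarrow> (real \<Rightarrow> real) \<Rightarrow>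
     ((real \<Rightarrow> 'k) set \<Rightarrow> 'a) \<Rightarrow> bool" where
  "L2_unitary u I J \<mu> w U \<longleftrightarrow>
     (\<forall>f\<in>sq_fields u I J \<mu> w. \<forall>g\<in>sq_fields u I J \<mu> w.
        U (ae_class u I J \<mu> (\<lambda>t. f t + g t)) = U (ae_class u I J \<mu> f) + U (ae_class u I J \<mu> g)) \<and>
     (\<forall>c. \<forall>f\<in>sq_fields u I J \<mu> w.
        U (ae_class u I J \<mu> (\<lambda>t. c *\<^sub>C f t)) = c *\<^sub>C U (ae_class u I J \<mu> f)) \<and>
     (\<forall>f\<in>sq_fields u I J \<mu> w. \<forall>g\<in>sq_fields u I J \<mu> w.
        cinner (U (ae_class u I J \<mu> f)) (U (ae_class u I J \<mu> g)) =
          (LINT t|completion \<mu>. complex_of_real (w t) * cinner (f t) (g t))) \<and>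
     U ` L2_fields u I J \<mu> w = UNIV"

definition uu :: "(nat \<Rightarrow> 'a) \<Rightarrow> (real \<Rightarrow> 'a \<Rightarrow> 'k::complex_hilbert_space) \<Rightarrow> nat \<Rightarrow> real \<Rightarrow> 'k"
  where "uu u J n t = inverse (complex_of_real t - \<i>) *\<^sub>C J t (u n)"

text \<open>\<open>U\<close> is the unitary operator from the model space onto \<open>'a\<close> extending
  \<open>\<Sum> \<alpha> \<chi>\<^sub>B uu\<^sub>n \<mapsto> \<Sum> \<alpha> E(B) u\<^sub>n\<close>.\<close>

definition model_unitary ::
    "(real set \<Rightarrow> 'a \<Rightarrow> 'a) \<Rightarrow> (nat \<Rightarrow> 'a::complex_hilbert_space) \<Rightarrow> nat set \<Rightarrow>
     (real \<Rightarrow> 'a \<Rightarrow> 'k::complex_hilbert_space) \<Rightarrow> real measure \<Rightarrow>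
     ((real \<Rightarrow> 'k) set \<Rightarrow> 'a) \<Rightarrow> bool" where
  "model_unitary E u I J \<mu> U \<longleftrightarrow>
     L2_unitary u I J \<mu> (\<lambda>t. 1 + t\<^sup>2) U \<and>
     (\<forall>S \<alpha>. finite S \<longrightarrow> S \<subseteq> sets borel \<times> I \<longrightarrow>
        U (ae_class u I J \<mu> (\<lambda>t. \<Sum>(B, n)\<in>S. (\<alpha> B n * indicator B t) *\<^sub>C uu u J n t)) =
          (\<Sum>(B, n)\<in>S. \<alpha> B n *\<^sub>C E B (u n)))"

definition model_H ::
    "(nat \<Rightarrow> 'a::complex_hilbert_space) \<Rightarrow> nat set \<Rightarrow>
     (real \<Rightarrow> 'a \<Rightarrow> 'k::complex_hilbert_space) \<Rightarrow> real measure \<Rightarrow>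
     ((real \<Rightarrow> 'k) set \<times> (real \<Rightarrow> 'k) set) set" where
  "model_H u I J \<mu> =
     {(ae_class u I J \<mu> f, ae_class u I J \<mu> (\<lambda>t. complex_of_real t *\<^sub>C f t)) | f.
        f \<in> sq_fields u I J \<mu> (\<lambda>t. (1 + t\<^sup>2) * (1 + t\<^sup>2))}"

definition model_Hdot ::
    "'a set \<Rightarrow> (nat \<Rightarrow> 'a::complex_hilbert_space) \<Rightarrow> nat set \<Rightarrow>
     (real \<Rightarrow> 'a \<Rightarrow> 'k::complex_hilbert_space) \<Rightarrow> real measure \<Rightarrow>
     ((real \<Rightarrow> 'k) set \<times> (real \<Rightarrow> 'k) set) set" where
  "model_Hdot N u I J \<mu> =
     {(ae_class u I J \<mu> f, ae_class u I J \<mu> (\<lambda>t. complex_of_real t *\<^sub>C f t)) | f.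
        f \<in> sq_fields u I J \<mu> (\<lambda>t. (1 + t\<^sup>2) * (1 + t\<^sup>2)) \<and>
        (\<forall>\<xi>\<in>N. \<forall>g\<in>Lambda_ext u I J \<mu> \<xi>.
           (LINT t|completion \<mu>. complex_of_real (1 + t\<^sup>2) * cinner (g t) (f t)) = 0)}"

definition model_N ::
    "(nat \<Rightarrow> 'a::complex_hilbert_space) \<Rightarrow> nat set \<Rightarrow>
     (real \<Rightarrow> 'a \<Rightarrow> 'k::complex_hilbert_space) \<Rightarrow> real measure \<Rightarrow> (real \<Rightarrow> 'k) set set" where
  "model_N u I J \<mu> =
     ae_class u I J \<mu> ` {f \<in> sq_fields u I J \<mu> (\<lambda>t. 1 + t\<^sup>2).
       \<forall>e>0. \<exists>S \<beta>. finite S \<and> S \<subseteq> I \<and>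
         wnorm2 \<mu> (\<lambda>t. 1 + t\<^sup>2) (\<lambda>t. f t - (\<Sum>n\<in>S. \<beta> n *\<^sub>C uu u J n t)) < e}"

end

theory Submission
  imports Defs "HOL-Probability.Distribution_Functions"
begin

text \<open>Testing against the total set of the fields \<open>\<chi>\<^sub>B uu\<^sub>n\<close> shows that \<open>U\<close> turns \<open>E(B)\<close> into
  multiplication by \<open>\<chi>\<^sub>B\<close>.  Hence \<open>\<parallel>F(t) U f\<parallel>\<^sup>2\<close> is the distribution function of the measure with
  density \<open>(1 + t\<^sup>2) \<parallel>f(t)\<parallel>\<^sup>2\<close>, so \<open>H\<close> and the transported multiplication operator have the same domain
  and the same quadratic form, and therefore agree.

  Since \<open>Hdot\<close> is closed and symmetric, the range of \<open>Hdot + \<i>\<close> is the orthogonal complement of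
  \<open>N = ker (Hdot\<^sup>* - \<i>)\<close>, and \<open>H + \<i>\<close> is injective; thus \<open>Hdot\<close> is the restriction of \<open>H\<close> to those \<open>x\<close>
  for which \<open>(H + \<i>) x\<close> is orthogonal to \<open>N\<close>.  As \<open>\<xi> = U ((t - \<i>)\<^sup>-\<^sup>1 \<Lambda>\<xi>)\<close> for \<open>\<xi>\<close> in \<open>N\<close>, in the model
  space this is the condition \<open>\<integral> (1 + t\<^sup>2) (\<Lambda>\<xi>, f) d\<mu> = 0\<close>.\<close>

section \<open>Complex Hilbert spaces\<close>

interpretation scaleC: vector_space "scaleC :: complex \<Rightarrow> 'a \<Rightarrow> 'a::complex_hilbert_space"
  by (rule vector_space_scaleC)

lemma cinner_add_left: "cinner (x + y) z = cinner x z + cinner y z"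
  by (metis cinner_add_right cinner_commute complex_cnj_add)

lemma cinner_scaleC_left: "cinner (c *\<^sub>C x) z = cnj c * cinner x z"
  by (metis cinner_scaleC_right cinner_commute complex_cnj_mult)

lemma cinner_zero_right [simp]: "cinner x 0 = 0"
  by (metis add_cancel_right_right cinner_add_right)

lemma cinner_zero_left [simp]: "cinner 0 x = 0"
  by (metis cinner_commute cinner_zero_right complex_cnj_zero)

lemma cinner_minus_right [simp]: "cinner x (- y) = - cinner x y"
  by (metis add.right_inverse add_eq_0_iff cinner_add_right cinner_zero_right)

lemma cinner_minus_left [simp]: "cinner (- x) y = - cinner x y"
  by (metis cinner_commute cinner_minus_right complex_cnj_minus)

lemma cinner_diff_right: "cinner x (y - z) = cinner x y - cinner x z"
  by (metis cinner_add_right cinner_minus_right diff_conv_add_uminus)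

lemma cinner_self: "cinner x x = complex_of_real ((norm x)\<^sup>2)"
proof -
  have "Im (cinner x x) = 0"
    by (metis cinner_commute cnj.sel(2) equal_neg_zero)
  moreover have "Re (cinner x x) = (norm x)\<^sup>2"
    by (metis inner_eq_Re_cinner power2_norm_eq_inner)
  ultimately show ?thesis
    by (simp add: complex_eq_iff)
qed

lemma norm_scaleC: "norm (c *\<^sub>C x) = cmod c * norm x"
proof -
  have "complex_of_real ((norm (c *\<^sub>C x))\<^sup>2) = complex_of_real ((cmod c * norm x)\<^sup>2)"
    unfolding cinner_self [of "c *\<^sub>C x", symmetric]
    unfolding cinner_scaleC_left cinner_scaleC_right unfolding cinner_self
    by (simp add: power_mult_distrib complex_norm_square [symmetric] mult.assoc [symmetric])
  then show ?thesis
    unfolding of_real_eq_iff by (rule power2_eq_imp_eq) simp_all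
qed

lemma Im_cinner: "Im (cinner x y) = inner (\<i> *\<^sub>C x) y"
  by (simp add: inner_eq_Re_cinner cinner_scaleC_left)

text \<open>The imaginary part is again a real inner product, with the first argument rotated by
  \<open>\<i>\<close>. Limits, measurability and orthogonality for \<open>cinner\<close> are thereby
  reduced to \<open>inner\<close>.\<close>

lemma cinner_expand: "cinner x y = Complex (inner x y) (inner (\<i> *\<^sub>C x) y)"
  by (simp add: complex_eq_iff Im_cinner inner_eq_Re_cinner)

lemma cinner_eq_0_all_imp: "(\<And>x. cinner x y = 0) \<Longrightarrow> y = 0"
  by (metis cinner_self norm_eq_zero of_real_eq_0_iff power_eq_0_iff)

lemma cmod_cinner_le: "cmod (cinner x y) \<le> norm x * norm y"
proof (cases "cinner x y = 0")
  case False
  \<comment> \<open>Multiplying \<open>y\<close> by the phase \<open>c\<close> of modulus one makes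
    the product real and nonnegative, so that the real Cauchy-Schwarz inequality applies.\<close>
  define c where "c = cnj (cinner x y) / cmod (cinner x y)"
  have "c * cinner x y = cmod (cinner x y)"
    using False by (simp add: c_def complex_norm_square [symmetric] mult.commute power2_eq_square)
  then have "cmod (cinner x y) = inner x (c *\<^sub>C y)"
    by (simp add: inner_eq_Re_cinner cinner_scaleC_right)
  also have "\<dots> \<le> norm x * norm (c *\<^sub>C y)"
    by (rule norm_cauchy_schwarz)
  also have "norm (c *\<^sub>C y) = norm y"
    using False by (simp add: norm_scaleC c_def norm_divide)
  finally show ?thesis .
qed simp

lemma tendsto_cinner:
  fixes f :: "'a \<Rightarrow> 'b::complex_hilbert_space"
  assumes "(f \<longlongrightarrow> x) G" "(g \<longlongrightarrow> y) G"
  shows "((\<lambda>i. cinner (f i) (g i)) \<longlongrightarrow> cinner x y) G"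
proof -
  have "bounded_linear (\<lambda>z. \<i> *\<^sub>C (z::'b))"
    by (rule bounded_linear_intro [of _ 1])
       (simp_all add: scaleC_add_right norm_scaleC scaleR_scaleC scaleC_scaleC mult.commute)
  then have "((\<lambda>i. \<i> *\<^sub>C f i) \<longlongrightarrow> \<i> *\<^sub>C x) G"
    by (rule bounded_linear.tendsto) fact
  then show ?thesis
    unfolding cinner_expand using assms by (intro tendsto_Complex tendsto_inner)
qed

lemma tendsto_scaleC:
  fixes f :: "'b \<Rightarrow> 'a::complex_hilbert_space"
  assumes "(c \<longlongrightarrow> a) G" "(f \<longlongrightarrow> x) G"
  shows "((\<lambda>i. c i *\<^sub>C f i) \<longlongrightarrow> a *\<^sub>C x) G"
proof -
  have "bounded_bilinear (\<lambda>c (x::'a). c *\<^sub>C x)"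
    by standard
       (auto simp: scaleC_add_right scaleC_add_left norm_scaleC scaleR_scaleC scaleC_scaleC
         scaleR_conv_of_real mult.commute intro!: exI [of _ 1])
  then show ?thesis
    by (rule bounded_bilinear.tendsto) fact+
qed

lemma cspan_image_sum:
  fixes u :: "'b \<Rightarrow> 'a::complex_hilbert_space"
  assumes "v \<in> cspan (u ` I)"
  obtains S \<beta> where "finite S" "S \<subseteq> I" "v = (\<Sum>n\<in>S. \<beta> n *\<^sub>C u n)"
proof -
  obtain T r where T: "finite T" "T \<subseteq> u ` I" "v = (\<Sum>a\<in>T. r a *\<^sub>C a)"
    using assms unfolding scaleC.span_explicit by auto
  obtain S where S: "S \<subseteq> I" "inj_on u S" "T = u ` S"
    using T(2) unfolding subset_image_inj by blast
  show thesis
  proof (rule that [of S "\<lambda>n. r (u n)"])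
    show "finite S" using T(1) S finite_imageD by blast
    show "v = (\<Sum>n\<in>S. r (u n) *\<^sub>C u n)"
      unfolding T(3) S(3) by (simp add: sum.reindex [OF S(2)])
  qed fact
qed

text \<open>Translates convergence of the extended real \<open>wnorm2\<close>, as in the definition
  of \<open>Lambda_ext\<close>, into convergence of vectors.\<close>

lemma tendsto_ennreal_dist_iff:
  fixes v :: "nat \<Rightarrow> 'a::metric_space"
  shows "(\<lambda>j. ennreal ((dist (v j) x)\<^sup>2)) \<longlonglongrightarrow> 0 \<longleftrightarrow> v \<longlonglongrightarrow> x"
proof -
  have "(\<lambda>j. ennreal ((dist (v j) x)\<^sup>2)) \<longlonglongrightarrow> 0 \<longleftrightarrow> (\<lambda>j. (dist (v j) x)\<^sup>2) \<longlonglongrightarrow> 0"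
    using tendsto_ennreal_iff [of "\<lambda>j. (dist (v j) x)\<^sup>2" sequentially 0] by simp
  also have "\<dots> \<longleftrightarrow> (\<lambda>j. dist (v j) x) \<longlonglongrightarrow> 0"
    by (simp add: power_tendsto_0_iff)
  also have "\<dots> \<longleftrightarrow> v \<longlonglongrightarrow> x"
    by (rule tendsto_dist_iff [symmetric])
  finally show ?thesis .
qed

lemma ortho_closure:
  assumes "x \<in> ortho S" shows "x \<in> ortho (closure S)"
proof -
  have "cinner y x = 0" if y: "y \<in> closure S" for y
  proof -
    obtain s where s: "\<And>n. s n \<in> S" "s \<longlonglongrightarrow> y"
      using y unfolding closure_sequential by blast
    have "(\<lambda>n. cinner (s n) x) \<longlonglongrightarrow> cinner y x"
      by (intro tendsto_cinner s tendsto_const)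
    moreover have "(\<lambda>n. cinner (s n) x) = (\<lambda>n. 0)"
      using s(1) assms by (auto simp: ortho_def)
    ultimately show ?thesis
      by (simp add: LIMSEQ_const_iff)
  qed
  then show ?thesis by (simp add: ortho_def)
qed

section \<open>Orthogonal projection onto a closed subspace\<close>

text \<open>The parallelogram law makes a minimising sequence for the distance from \<open>x\<close>
  to \<open>M\<close> Cauchy, and minimality at its limit \<open>m\<close> forces
  orthogonality.\<close>

lemma orthogonal_projection_exists:
  fixes M :: "'a::complex_hilbert_space set"
  assumes "closed M" and sub: "scaleC.subspace M"
  obtains m where "m \<in> M" "x - m \<in> ortho M"
proof -
  have 0: "0 \<in> M" and add: "\<And>a b. a \<in> M \<Longrightarrow> b \<in> M \<Longrightarrow> a + b \<in> M"
    and sc: "\<And>c a. a \<in> M \<Longrightarrow> c *\<^sub>C a \<in> M"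
    using sub by (auto simp: scaleC.subspace_def)
  have scR: "r *\<^sub>R a \<in> M" if "a \<in> M" for a r
    using sc [OF that] by (simp add: scaleR_scaleC)
  define d where "d = infdist x M"
  have d: "d \<le> dist x a" if "a \<in> M" for a
    unfolding d_def by (rule infdist_le [OF that])
  have "\<exists>a\<in>M. dist x a < d + 1 / real (Suc n)" for n
    using 0 infdist_notempty [of M x] cInf_lessD [of "dist x ` M" "d + 1 / real (Suc n)"]
    by (force simp: d_def image_def)
  then obtain s where s: "\<And>n. s n \<in> M" "\<And>n. dist x (s n) < d + 1 / real (Suc n)"
    by metis
  have d0: "0 \<le> d" by (simp add: d_def infdist_nonneg)
  have lim: "(\<lambda>n. dist x (s n)) \<longlonglongrightarrow> d"
  proof (rule tendsto_sandwich [OF _ _ tendsto_const])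
    show "(\<lambda>n. d + 1 / real (Suc n)) \<longlonglongrightarrow> d"
      using tendsto_add [OF tendsto_const LIMSEQ_inverse_real_of_nat, of d] by (simp add: inverse_eq_divide)
    show "\<forall>\<^sub>F n in sequentially. d \<le> dist x (s n)"
      using d s(1) by (intro always_eventually) auto
    show "\<forall>\<^sub>F n in sequentially. dist x (s n) \<le> d + 1 / real (Suc n)"
      using s(2) by (intro always_eventually allI less_imp_le)
  qed
  \<comment> \<open>The parallelogram law for \<open>x - a\<close> and \<open>x - b\<close>; the
    midpoint of \<open>a\<close> and \<open>b\<close> lies in \<open>M\<close> and so has distance
    at least \<open>d\<close> from \<open>x\<close>.\<close>
  have par: "(dist a b)\<^sup>2 \<le> 2 * ((dist x a)\<^sup>2 - d\<^sup>2) + 2 * ((dist x b)\<^sup>2 - d\<^sup>2)"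
    if "a \<in> M" "b \<in> M" for a b
  proof -
    have "(1/2) *\<^sub>R (a + b) \<in> M" using that by (intro scR add)
    then have "d\<^sup>2 \<le> (dist x ((1/2) *\<^sub>R (a + b)))\<^sup>2"
      using d d0 power_mono by blast
    moreover have "(2 * dist x ((1/2) *\<^sub>R (a + b)))\<^sup>2 + (dist a b)\<^sup>2
        = 2 * (dist x a)\<^sup>2 + 2 * (dist x b)\<^sup>2"
    proof -
      have "2 * dist x ((1/2) *\<^sub>R (a + b)) = norm (2 *\<^sub>R (x - (1/2) *\<^sub>R (a + b)))"
        by (simp add: dist_norm)
      also have "2 *\<^sub>R (x - (1/2) *\<^sub>R (a + b)) = (x - a) + (x - b)"
        by (simp add: scaleR_diff_right scaleR_2)
      finally have 1: "2 * dist x ((1/2) *\<^sub>R (a + b)) = norm ((x - a) + (x - b))" .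
      have 2: "dist a b = norm ((x - a) - (x - b))"
        by (simp add: dist_norm norm_minus_commute)
      show ?thesis
        unfolding 1 2 unfolding dist_norm power2_norm_eq_inner
        by (simp only: inner_add_left inner_add_right inner_diff_left inner_diff_right) simp
    qed
    ultimately show ?thesis by (simp add: power_mult_distrib)
  qed
  have "Cauchy s"
  proof (rule metric_CauchyI)
    fix e :: real assume e: "0 < e"
    have "(\<lambda>n. (dist x (s n))\<^sup>2 - d\<^sup>2) \<longlonglongrightarrow> d\<^sup>2 - d\<^sup>2"
      by (intro tendsto_intros lim)
    then have "\<forall>\<^sub>F n in sequentially. (dist x (s n))\<^sup>2 - d\<^sup>2 < e\<^sup>2 / 4"
      using e by (intro order_tendstoD(2)) auto
    then obtain N where N: "\<And>n. n \<ge> N \<Longrightarrow> (dist x (s n))\<^sup>2 - d\<^sup>2 < e\<^sup>2 / 4"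
      by (auto simp: eventually_sequentially)
    have "dist (s m) (s n) < e" if "m \<ge> N" "n \<ge> N" for m n
    proof (rule power2_less_imp_less)
      show "(dist (s m) (s n))\<^sup>2 < e\<^sup>2"
        using par [OF s(1) s(1), of m n] add_strict_mono [OF N [OF that(1)] N [OF that(2)]]
        by (simp add: field_simps)
    qed (use e in simp)
    then show "\<exists>N. \<forall>m\<ge>N. \<forall>n\<ge>N. dist (s m) (s n) < e" by blast
  qed
  then obtain m where m: "s \<longlonglongrightarrow> m"
    by (metis Cauchy_convergent convergent_def)
  have mM: "m \<in> M"
    using \<open>closed M\<close> s(1) m by (metis closed_sequentially)
  have dm: "dist x m = d"
    by (rule LIMSEQ_unique [OF tendsto_dist [OF tendsto_const m] lim])
  have inner0: "inner y (x - m) = 0" if "y \<in> M" for y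
  proof (cases "y = 0")
    case False
    \<comment> \<open>The vector \<open>r *\<^sub>R y\<close> is the projection of
      \<open>x - m\<close> onto the real line through \<open>y\<close>. Moving \<open>m\<close> by
      it would bring it closer to \<open>x\<close> unless the inner product vanishes.\<close>
    define r where "r = inner y (x - m) / inner y y"
    have "m + r *\<^sub>R y \<in> M" by (intro add mM scR that)
    then have "d\<^sup>2 \<le> (dist x (m + r *\<^sub>R y))\<^sup>2"
      using d d0 power_mono by blast
    then have "(norm (x - m))\<^sup>2 \<le> (norm ((x - m) - r *\<^sub>R y))\<^sup>2"
      by (simp add: dm [symmetric] dist_norm diff_diff_eq)
    also have "\<dots> = (norm (x - m))\<^sup>2 - 2 * r * inner y (x - m) + r * (r * inner y y)"
      unfolding power2_norm_eq_inner inner_diff_left [of "x - m"] inner_diff_right [of _ "x - m"]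
      by (simp add: inner_commute)
    also have "r * inner y y = inner y (x - m)"
      using False by (simp add: r_def)
    finally have "r * inner y (x - m) \<le> 0" by simp
    then have "(inner y (x - m))\<^sup>2 / inner y y \<le> 0"
      by (simp add: r_def power2_eq_square)
    moreover have "0 < inner y y" using False by simp
    ultimately have "(inner y (x - m))\<^sup>2 \<le> 0"
      by (simp only: pos_divide_le_eq mult_zero_left)
    then show ?thesis by simp
  qed simp
  \<comment> \<open>Real orthogonality to \<open>y\<close> and to \<open>\<i> *\<^sub>C y\<close>,
    which lies in \<open>M\<close> as well, amounts to complex orthogonality to
    \<open>y\<close>.\<close>
  have "cinner y (x - m) = 0" if "y \<in> M" for y
    unfolding cinner_expand inner0 [OF that] inner0 [OF sc [OF that]] by (simp add: Complex_eq)
  then have "x - m \<in> ortho M"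
    by (simp add: ortho_def)
  then show thesis using that mM by blast
qed

text \<open>The component \<open>x - m\<close> of \<open>x\<close> orthogonal to \<open>M\<close> is
  orthogonal to both \<open>x\<close> and \<open>m\<close>, hence to itself.\<close>

lemma ortho_ortho_subset:
  fixes M :: "'a::complex_hilbert_space set"
  assumes "closed M" "scaleC.subspace M"
  shows "ortho (ortho M) \<subseteq> M"
proof
  fix x assume x: "x \<in> ortho (ortho M)"
  obtain m where m: "m \<in> M" "x - m \<in> ortho M"
    using orthogonal_projection_exists [OF assms] .
  have "cinner (x - m) x = 0" using x m by (simp add: ortho_def)
  moreover have "cinner (x - m) m = 0"
    using m by (metis (mono_tags, lifting) cinner_commute complex_cnj_zero mem_Collect_eq ortho_def)
  ultimately have "cinner (x - m) (x - m) = 0" by (simp add: cinner_diff_right)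
  then have "x = m" by (simp add: cinner_self)
  then show "x \<in> M" using m by simp
qed

section \<open>Symmetric operators\<close>

lemma linear_operatorD:
  assumes "linear_operator T"
  shows "single_valued T" "(0, 0) \<in> T"
    "(x, y) \<in> T \<Longrightarrow> (x', y') \<in> T \<Longrightarrow> (x + x', y + y') \<in> T"
    "(x, y) \<in> T \<Longrightarrow> (c *\<^sub>C x, c *\<^sub>C y) \<in> T"
  using assms by (auto simp: linear_operator_def)

lemma linear_operator_diff:
  assumes "linear_operator T" "(x, y) \<in> T" "(x', y') \<in> T"
  shows "(x - x', y - y') \<in> T"
  using linear_operatorD(3) [OF assms(1,2) linear_operatorD(4) [OF assms(1,3), of "-1"]]
  by (simp add: scaleC.scale_minus_left)

lemma symmetric_opD:
  assumes "symmetric_op T" "(x, y) \<in> T" "(v, w) \<in> T"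
  shows "cinner x w = cinner y v"
  using assms by (auto simp: symmetric_op_def adjoint_op_def)

text \<open>The cross terms cancel by symmetry. The identity yields both injectivity of
  \<open>T + \<i>\<close> and boundedness of its inverse.\<close>

lemma norm_symmetric_plus_i:
  assumes "symmetric_op T" "(x, y) \<in> T"
  shows "(norm (y + \<i> *\<^sub>C x))\<^sup>2 = (norm y)\<^sup>2 + (norm x)\<^sup>2"
proof -
  have "complex_of_real ((norm (y + \<i> *\<^sub>C x))\<^sup>2) = complex_of_real ((norm y)\<^sup>2 + (norm x)\<^sup>2)"
    unfolding of_real_add cinner_self [symmetric]
    unfolding cinner_add_left cinner_add_right cinner_scaleC_left cinner_scaleC_right
    by (simp add: symmetric_opD [OF assms(1,2,2)] right_diff_distrib)
  then show ?thesis unfolding of_real_eq_iff .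
qed

section \<open>The range of \<open>T + \<i>\<close> and its orthogonal complement\<close>

text \<open>By the norm identity, convergence of \<open>y + \<i> *\<^sub>C x\<close> along the graph
  makes \<open>x\<close> and \<open>y\<close> converge separately, and the limit pair stays in the
  closed graph.\<close>

lemma closed_range_symmetric_plus_i:
  assumes T: "symmetric_op T" and "closed T"
  shows "closed ((\<lambda>(x, y). y + \<i> *\<^sub>C x) ` T)"
proof -
  have lin: "linear_operator T" using T by (simp add: symmetric_op_def)
  show ?thesis unfolding closed_sequential_limits
  proof (intro allI impI, elim conjE)
    fix s l assume "\<forall>n. s n \<in> (\<lambda>(x, y). y + \<i> *\<^sub>C x) ` T" and l: "s \<longlonglongrightarrow> l"
    then have "\<forall>n. \<exists>x y. (x, y) \<in> T \<and> s n = y + \<i> *\<^sub>C x" by (fastforce simp: image_iff)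
    then obtain a b where ab: "\<And>n. (a n, b n) \<in> T" "\<And>n. s n = b n + \<i> *\<^sub>C a n" by metis
    have nrm: "(norm (s m - s n))\<^sup>2 = (norm (b m - b n))\<^sup>2 + (norm (a m - a n))\<^sup>2" for m n
      using norm_symmetric_plus_i [OF T linear_operator_diff [OF lin ab(1) ab(1)], of m n]
      by (simp add: ab(2) scaleC.scale_right_diff_distrib algebra_simps)
    have le: "norm (a m - a n) \<le> norm (s m - s n)" "norm (b m - b n) \<le> norm (s m - s n)" for m n
      by (rule power2_le_imp_le; simp add: nrm)+
    have "Cauchy s" using l by (rule LIMSEQ_imp_Cauchy)
    then have "Cauchy a" "Cauchy b"
      unfolding Cauchy_def dist_norm using le order.strict_trans1 by meson+
    then obtain x y where xy: "a \<longlonglongrightarrow> x" "b \<longlonglongrightarrow> y"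
      by (metis Cauchy_convergent convergent_def)
    then have "(\<lambda>n. (a n, b n)) \<longlonglongrightarrow> (x, y)" by (intro tendsto_Pair)
    then have "(x, y) \<in> T"
      by (rule closed_sequentially [OF \<open>closed T\<close> ab(1)])
    moreover have "(\<lambda>n. b n + \<i> *\<^sub>C a n) \<longlonglongrightarrow> y + \<i> *\<^sub>C x"
      by (intro tendsto_add tendsto_scaleC tendsto_const xy)
    then have "s \<longlonglongrightarrow> y + \<i> *\<^sub>C x"
      by (simp only: ab(2) [symmetric])
    ultimately show "l \<in> (\<lambda>(x, y). y + \<i> *\<^sub>C x) ` T"
      using LIMSEQ_unique [OF l] by (intro image_eqI [of _ _ "(x, y)"]) simp_all
  qed
qed

text \<open>After conjugation, the vanishing of \<open>cinner (y + \<i> *\<^sub>C x) z\<close> is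
  the defining relation of the adjoint for the pair \<open>(z, \<i> *\<^sub>C z)\<close>.\<close>

lemma ortho_range_symmetric_plus_i:
  "ortho ((\<lambda>(x, y). y + \<i> *\<^sub>C x) ` T) = defect_space T \<i>"
proof -
  have "cinner (y + \<i> *\<^sub>C x) z = 0 \<longleftrightarrow> cinner z y = cinner (\<i> *\<^sub>C z) x" for x y z :: 'a
  proof -
    have "cinner (y + \<i> *\<^sub>C x) z = 0 \<longleftrightarrow> cinner z (y + \<i> *\<^sub>C x) = 0"
      by (metis cinner_commute complex_cnj_zero)
    then show ?thesis
      by (simp add: cinner_add_right cinner_scaleC_right cinner_scaleC_left add_eq_0_iff2)
  qed
  then show ?thesis
    by (auto simp: ortho_def defect_space_def adjoint_op_def)
qed

text \<open>The orthogonality condition puts \<open>y + \<i> *\<^sub>C x\<close> into the double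
  orthogonal complement of the range of \<open>T + \<i>\<close>, which is closed. Injectivity of
  \<open>H + \<i>\<close> then identifies \<open>(x, y)\<close> with the preimage found in
  \<open>T\<close>.\<close>

lemma closed_symmetric_op_iff_extension:
  assumes T: "symmetric_op T" "closed T" and H: "symmetric_op H" "T \<subseteq> H"
  shows "(x, y) \<in> T \<longleftrightarrow> (x, y) \<in> H \<and> (\<forall>\<xi>\<in>defect_space T \<i>. cinner \<xi> (y + \<i> *\<^sub>C x) = 0)"
proof
  assume xy: "(x, y) \<in> T"
  then have "cinner \<xi> (y + \<i> *\<^sub>C x) = 0" if "\<xi> \<in> defect_space T \<i>" for \<xi>
    using that unfolding ortho_range_symmetric_plus_i [symmetric]
    by (force simp: ortho_def intro: cinner_commute [THEN trans])
  then show "(x, y) \<in> H \<and> (\<forall>\<xi>\<in>defect_space T \<i>. cinner \<xi> (y + \<i> *\<^sub>C x) = 0)"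
    using xy H by auto
next
  let ?R = "(\<lambda>(x, y). y + \<i> *\<^sub>C x) ` T"
  assume xy: "(x, y) \<in> H \<and> (\<forall>\<xi>\<in>defect_space T \<i>. cinner \<xi> (y + \<i> *\<^sub>C x) = 0)"
  have lin: "linear_operator T" and linH: "linear_operator H"
    using T H by (simp_all add: symmetric_op_def)
  have "scaleC.subspace ?R"
  proof (rule scaleC.subspaceI)
    show "0 \<in> ?R" using linear_operatorD(2) [OF lin] by (force intro!: image_eqI)
  next
    fix v w assume "v \<in> ?R" "w \<in> ?R"
    then obtain a b a' b' where "(a, b) \<in> T" "v = b + \<i> *\<^sub>C a" "(a', b') \<in> T" "w = b' + \<i> *\<^sub>C a'"
      by auto
    then show "v + w \<in> ?R"
      by (intro image_eqI [OF _ linear_operatorD(3) [OF lin, of a b a' b']])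
         (simp_all add: scaleC_add_right)
  next
    fix c v assume "v \<in> ?R"
    then obtain a b where "(a, b) \<in> T" "v = b + \<i> *\<^sub>C a" by auto
    then show "c *\<^sub>C v \<in> ?R"
      by (intro image_eqI [OF _ linear_operatorD(4) [OF lin, of a b c]])
         (simp_all add: scaleC_add_right scaleC_scaleC mult.commute)
  qed
  moreover have "y + \<i> *\<^sub>C x \<in> ortho (ortho ?R)"
    using xy unfolding ortho_range_symmetric_plus_i by (simp add: ortho_def)
  ultimately have "y + \<i> *\<^sub>C x \<in> ?R"
    using ortho_ortho_subset [OF closed_range_symmetric_plus_i [OF T]] by blast
  then obtain x' y' where x'y': "(x', y') \<in> T" "y + \<i> *\<^sub>C x = y' + \<i> *\<^sub>C x'" by auto
  have "(x - x', y - y') \<in> H"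
    using xy x'y' H by (intro linear_operator_diff [OF linH]) auto
  moreover have "(y - y') + \<i> *\<^sub>C (x - x') = 0"
    using x'y'(2) by (simp add: scaleC.scale_right_diff_distrib algebra_simps)
  ultimately have "(norm (y - y'))\<^sup>2 + (norm (x - x'))\<^sup>2 = 0"
    using norm_symmetric_plus_i [OF H(1)] by fastforce
  then show "(x, y) \<in> T"
    using x'y'(1) by (simp add: add_nonneg_eq_0_iff)
qed

section \<open>Operators determined by their quadratic forms\<close>

text \<open>Besides the domain, \<open>spectral_family\<close> prescribes only the diagonal values
  \<open>cinner x y\<close> for \<open>(x, y) \<in> H\<close>. Polarization gives the values against
  every vector of the dense domain, and these fix the operator.\<close>

lemma linear_operator_eqI_quadratic_form:
  assumes A: "linear_operator A" and B: "linear_operator B"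
    and dom: "Domain A = Domain B" and dense: "densely_defined A"
    and form: "\<And>x y z. (x, y) \<in> A \<Longrightarrow> (x, z) \<in> B \<Longrightarrow> cinner x y = cinner x z"
  shows "A = B"
proof -
  have eq: "y = z" if xy: "(x, y) \<in> A" and xz: "(x, z) \<in> B" for x y z
  proof -
    have "cinner v (y - z) = 0" if v: "v \<in> Domain A" for v
    proof -
      obtain p q where p: "(v, p) \<in> A" and q: "(v, q) \<in> B"
        using v dom by (metis DomainE)
      let ?s = "cinner v y - cinner v z" and ?t = "cinner x p - cinner x q"
      have *: "c * ?s + cnj c * ?t = 0" for c
      proof -
        have "cinner (v + c *\<^sub>C x) (p + c *\<^sub>C y) = cinner (v + c *\<^sub>C x) (q + c *\<^sub>C z)"
          by (intro form linear_operatorD(3) [OF A] linear_operatorD(3) [OF B]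
              linear_operatorD(4) [OF A] linear_operatorD(4) [OF B] p q xy xz)
        then have "cinner v p + cnj c * cinner x p + c * (cinner v y + cnj c * cinner x y)
            = cinner v q + cnj c * cinner x q + c * (cinner v z + cnj c * cinner x z)"
          by (simp only: cinner_add_left cinner_add_right cinner_scaleC_left cinner_scaleC_right)
        then show ?thesis
          unfolding form [OF p q] form [OF xy xz] by algebra
      qed
      \<comment> \<open>The choice \<open>c = 1\<close> gives \<open>?s + ?t = 0\<close>, and
        \<open>c = \<i>\<close> gives \<open>?s - ?t = 0\<close>.\<close>
      have "?s = 0"
        using * [of 1] * [of \<i>] by (auto simp: complex_eq_iff)
      then show ?thesis by (simp add: cinner_diff_right)
    qed
    then have "y - z \<in> ortho (closure (Domain A))"
      by (intro ortho_closure) (simp add: ortho_def)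
    then have "y - z = 0"
      using dense by (intro cinner_eq_0_all_imp) (simp add: ortho_def densely_defined_def)
    then show ?thesis by simp
  qed
  show ?thesis
  proof (rule set_eqI, clarify)
    fix x y
    show "(x, y) \<in> A \<longleftrightarrow> (x, y) \<in> B"
      using eq dom by (metis Domain.DomainI Domain_iff)
  qed
qed

section \<open>Measurable fields of vectors\<close>

lemma sigma_finite_completion:
  assumes "sigma_finite_measure M"
  shows "sigma_finite_measure (completion M)"
proof -
  obtain A where A: "countable A" "A \<subseteq> sets M" "\<Union>A = space M" "\<forall>a\<in>A. emeasure M a \<noteq> \<infinity>"
    using sigma_finite_measure.sigma_finite_countable [OF assms] by blast
  have "emeasure (completion M) a \<noteq> \<infinity>" if "a \<in> A" for a
    using A that by (subst emeasure_completion) (auto simp: main_part)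
  then show ?thesis
    using A by (intro sigma_finite_measure.intro exI [of _ A]) auto
qed

text \<open>In the completion, a set that agrees almost everywhere with a measurable set is
  measurable. This is applied to the Gram functions of \<open>J\<close>, which equal the densities
  \<open>\<phi>\<close> only almost everywhere.\<close>

lemma measurable_AE_cong_completion:
  assumes f: "f \<in> measurable (completion M) N"
    and AE: "AE x in completion M. f x = g x"
    and g: "g \<in> space M \<rightarrow> space N"
  shows "g \<in> measurable (completion M) N"
proof (rule measurableI)
  fix A assume A: "A \<in> sets N"
  show "g -` A \<inter> space (completion M) \<in> sets (completion M)"
  proof (rule completion.in_sets_AE)
    show "f -` A \<inter> space (completion M) \<in> sets (completion M)"
      using f A by (rule measurable_sets)
    show "AE x in completion M.
        x \<in> f -` A \<inter> space (completion M) \<longleftrightarrow> x \<in> g -` A \<inter> space (completion M)"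
      using AE by eventually_elim simp
  qed simp
qed (use g in auto)

text \<open>The criterion \<open>density_zero\<close> tests on all sets of the completed
  sigma-algebra. Each of them differs by a null set from its \<open>main_part\<close>, which belongs
  to \<open>M\<close>.\<close>

lemma AE_eq_0_completion:
  fixes h :: "'a \<Rightarrow> 'b::{second_countable_topology, banach}"
  assumes "sigma_finite_measure M" and h: "integrable (completion M) h"
    and 0: "\<And>B. B \<in> sets M \<Longrightarrow> (LINT t|completion M. indicator B t *\<^sub>R h t) = 0"
  shows "AE t in M. h t = 0"
proof -
  interpret sigma_finite_measure "completion M"
    by (rule sigma_finite_completion) fact
  have "AE t in completion M. h t = 0"
  proof (rule density_zero [OF h])
    fix A assume A: "A \<in> sets (completion M)"
    have m: "h \<in> borel_measurable (completion M)" using h by simp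
    have "(LINT t|completion M. indicator A t *\<^sub>R h t)
        = (LINT t|completion M. indicator (main_part M A) t *\<^sub>R h t)"
    proof (rule integral_cong_AE)
      show "(\<lambda>t. indicator A t *\<^sub>R h t) \<in> borel_measurable (completion M)"
        "(\<lambda>t. indicator (main_part M A) t *\<^sub>R h t) \<in> borel_measurable (completion M)"
        using A m by (auto intro!: borel_measurable_scaleR borel_measurable_indicator)
      show "AE t in completion M.
          indicator A t *\<^sub>R h t = indicator (main_part M A) t *\<^sub>R h t"
        using AE_completion [OF AE_in_main_part [OF A]] by eventually_elim (simp add: indicator_def)
    qed
    also have "\<dots> = 0" using A by (intro 0) auto
    finally show "set_lebesgue_integral (completion M) A h = 0"
      by (simp add: set_lebesgue_integral_def)
  qed
  then show ?thesis by (simp add: AE_completion_iff)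
qed

text \<open>The expression under the supremum is \<open>(norm x)\<^sup>2 - (dist v x)\<^sup>2\<close>.  For countable \<open>D\<close> this
  form makes \<open>norm (f t)\<close> measurable although \<open>D\<close> varies with \<open>t\<close>.\<close>

lemma norm2_eq_SUP_closure:
  fixes x :: "'a::complex_hilbert_space"
  assumes "x \<in> closure D"
  shows "bdd_above ((\<lambda>v. 2 * inner v x - (norm v)\<^sup>2) ` D)"
    and "(norm x)\<^sup>2 = (SUP v\<in>D. 2 * inner v x - (norm v)\<^sup>2)"
proof -
  have eq: "2 * inner v x - (norm v)\<^sup>2 = (norm x)\<^sup>2 - (dist v x)\<^sup>2" for v
    unfolding dist_norm power2_norm_eq_inner by (simp add: inner_diff inner_commute)
  show "bdd_above ((\<lambda>v. 2 * inner v x - (norm v)\<^sup>2) ` D)"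
    unfolding eq by (rule bdd_aboveI2 [of _ _ "(norm x)\<^sup>2"]) simp
  obtain v where v: "\<And>n. v n \<in> D" "v \<longlonglongrightarrow> x"
    using assms unfolding closure_sequential by blast
  have "(\<lambda>n. (norm x)\<^sup>2 - (dist (v n) x)\<^sup>2) \<longlonglongrightarrow> (norm x)\<^sup>2 - (dist x x)\<^sup>2"
    by (intro tendsto_intros v)
  then have lim: "(\<lambda>n. (norm x)\<^sup>2 - (dist (v n) x)\<^sup>2) \<longlonglongrightarrow> (norm x)\<^sup>2" by simp
  show "(norm x)\<^sup>2 = (SUP v\<in>D. 2 * inner v x - (norm v)\<^sup>2)"
    unfolding eq
  proof (rule antisym)
    have "bdd_above ((\<lambda>v. (norm x)\<^sup>2 - (dist v x)\<^sup>2) ` D)"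
      by (rule bdd_aboveI2 [of _ _ "(norm x)\<^sup>2"]) simp
    then show "(norm x)\<^sup>2 \<le> (SUP v\<in>D. (norm x)\<^sup>2 - (dist v x)\<^sup>2)"
      using v(1) by (intro LIMSEQ_le_const2 [OF lim]) (auto intro: cSUP_upper2)
    show "(SUP v\<in>D. (norm x)\<^sup>2 - (dist v x)\<^sup>2) \<le> (norm x)\<^sup>2"
      using v(1) by (intro cSUP_least) auto
  qed
qed

section \<open>Countable dense families in spans\<close>

text \<open>The coefficients are Gaussian rationals. Indexing by lists gives a countable index set
  that stays the same when the vectors \<open>x n\<close> vary with a parameter.\<close>

definition rat_comb :: "(nat \<Rightarrow> 'k::complex_hilbert_space) \<Rightarrow> (rat \<times> rat \<times> nat) list \<Rightarrow> 'k" where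
  "rat_comb x l = (\<Sum>(p, q, n)\<leftarrow>l. Complex (of_rat p) (of_rat q) *\<^sub>C x n)"

lemma rat_comb_simps [simp]:
  "rat_comb x [] = 0"
  "rat_comb x ((p, q, n) # l) = Complex (of_rat p) (of_rat q) *\<^sub>C x n + rat_comb x l"
  by (simp_all add: rat_comb_def)

lemma rational_complex_approx:
  assumes "0 < e"
  obtains p q where "cmod (Complex (of_rat p) (of_rat q) - c) < e"
proof -
  obtain p where p: "Re c < of_rat p" "of_rat p < Re c + e / 2"
    using of_rat_dense [of "Re c" "Re c + e / 2"] assms by auto
  obtain q where q: "Im c < of_rat q" "of_rat q < Im c + e / 2"
    using of_rat_dense [of "Im c" "Im c + e / 2"] assms by auto
  have "cmod (Complex (of_rat p) (of_rat q) - c)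
      \<le> \<bar>of_rat p - Re c\<bar> + \<bar>of_rat q - Im c\<bar>"
    using cmod_le [of "Complex (of_rat p) (of_rat q) - c"] by simp
  also have "\<dots> < e" using p q by simp
  finally show thesis by (rule that)
qed

lemma span_subset_closure_rat_comb:
  fixes x :: "nat \<Rightarrow> 'k::complex_hilbert_space"
  assumes "y \<in> cspan (x ` I)"
  shows "y \<in> closure (rat_comb x ` lists (UNIV \<times> UNIV \<times> I))"
  using assms
proof (induction rule: scaleC.span_induct_alt)
  case base
  have "rat_comb x [] \<in> rat_comb x ` lists (UNIV \<times> UNIV \<times> I)"
    by (intro imageI) simp
  then show ?case using closure_subset by (metis rat_comb_simps(1) subsetD)
next
  case (step c z y)
  then obtain n where n: "n \<in> I" "z = x n" by auto
  show ?case unfolding closure_approachable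
  proof (intro allI impI)
    fix e :: real assume e: "0 < e"
    \<comment> \<open>The \<open>+ 1\<close> keeps the divisor positive when
      \<open>z = 0\<close>.\<close>
    then have "0 < e / 2 / (norm z + 1)"
      by (simp add: add_nonneg_pos)
    then obtain p q where "cmod (Complex (of_rat p) (of_rat q) - c) < e / 2 / (norm z + 1)"
      using rational_complex_approx by metis
    then have pq: "cmod (Complex (of_rat p) (of_rat q) - c) * (norm z + 1) < e / 2"
      by (simp only: pos_less_divide_eq add_nonneg_pos norm_ge_zero zero_less_one)
    have "\<exists>y'\<in>rat_comb x ` lists (UNIV \<times> UNIV \<times> I). dist y' y < e / 2"
      using step(2) e unfolding closure_approachable by (meson half_gt_zero)
    then obtain l where l: "l \<in> lists (UNIV \<times> UNIV \<times> I)" "dist (rat_comb x l) y < e / 2"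
      by blast
    have "rat_comb x ((p, q, n) # l) - (c *\<^sub>C z + y)
        = (Complex (of_rat p) (of_rat q) - c) *\<^sub>C z + (rat_comb x l - y)"
      by (simp add: n(2) scaleC.scale_left_diff_distrib)
    then have "dist (rat_comb x ((p, q, n) # l)) (c *\<^sub>C z + y)
        = norm ((Complex (of_rat p) (of_rat q) - c) *\<^sub>C z + (rat_comb x l - y))"
      by (simp only: dist_norm)
    also have "\<dots> \<le> cmod (Complex (of_rat p) (of_rat q) - c) * norm z + dist (rat_comb x l) y"
      using norm_triangle_ineq [of "(Complex (of_rat p) (of_rat q) - c) *\<^sub>C z" "rat_comb x l - y"]
      by (simp add: norm_scaleC dist_norm)
    also have "\<dots> < e / 2 + e / 2"
      using pq l(2) mult_left_mono [of "norm z" "norm z + 1"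
          "cmod (Complex (of_rat p) (of_rat q) - c)"]
      by (intro add_strict_mono) auto
    finally have "dist (rat_comb x ((p, q, n) # l)) (c *\<^sub>C z + y) < e" by simp
    then show "\<exists>y'\<in>rat_comb x ` lists (UNIV \<times> UNIV \<times> I). dist y' (c *\<^sub>C z + y) < e"
      using l(1) n(1) by (intro bexI [of _ "rat_comb x ((p, q, n) # l)"] imageI) auto
  qed
qed

section \<open>Fibres and measurable fields\<close>

text \<open>The densities \<open>\<phi>\<close> enter here only through
  \<open>gram_integrable\<close>, the integrability of the Gram functions of the generators.\<close>

locale measurable_fibres =
  fixes u :: "nat \<Rightarrow> 'a::complex_hilbert_space" and I :: "nat set"
    and J :: "real \<Rightarrow> 'a \<Rightarrow> 'k::complex_hilbert_space" and \<mu> :: "real measure"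
  assumes sets_mu: "sets \<mu> = sets borel"
    and sigma_finite: "sigma_finite_measure \<mu>"
    and J_add: "\<And>t v w. v \<in> cspan (u ` I) \<Longrightarrow> w \<in> cspan (u ` I) \<Longrightarrow> J t (v + w) = J t v + J t w"
    and J_scaleC: "\<And>t c v. v \<in> cspan (u ` I) \<Longrightarrow> J t (c *\<^sub>C v) = c *\<^sub>C J t v"
    and gram_integrable: "\<And>m n. m \<in> I \<Longrightarrow> n \<in> I \<Longrightarrow>
      integrable (completion \<mu>) (\<lambda>t. cinner (J t (u m)) (J t (u n)))"
begin

abbreviation M where "M \<equiv> completion \<mu>"
abbreviation fl where "fl \<equiv> fields u I J \<mu>"
abbreviation sq where "sq \<equiv> sq_fields u I J \<mu>"
abbreviation cls where "cls \<equiv> ae_class u I J \<mu>"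

lemma space_M [simp]: "space M = UNIV" "space \<mu> = UNIV"
  using sets_eq_imp_space_eq [OF sets_mu] by simp_all

lemma measurable_M: "f \<in> borel_measurable borel \<Longrightarrow> f \<in> borel_measurable M"
  by (intro measurable_completion) (simp cong: measurable_cong_sets add: sets_mu)

lemma sets_M_borel: "B \<in> sets borel \<Longrightarrow> B \<in> sets M"
  by (simp add: sets_mu)

lemma J_0: "J t 0 = 0"
  using J_scaleC [of 0 t 0] by (simp add: scaleC.span_zero)

lemma J_sum:
  assumes "finite S" "S \<subseteq> I"
  shows "J t (\<Sum>n\<in>S. \<beta> n *\<^sub>C u n) = (\<Sum>n\<in>S. \<beta> n *\<^sub>C J t (u n))"
  using assms
proof (induction S)
  case (insert n S)
  have span: "u m \<in> cspan (u ` I)" if "m \<in> insert n S" for m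
    using that insert.prems by (intro scaleC.span_base) auto
  then have "(\<Sum>n\<in>S. \<beta> n *\<^sub>C u n) \<in> cspan (u ` I)"
    by (intro scaleC.span_sum scaleC.span_scale) auto
  with insert span [of n] show ?case
    by (simp add: J_add J_scaleC scaleC.span_scale)
qed (simp add: J_0)

lemma J_in_span:
  assumes "v \<in> cspan (u ` I)"
  shows "J t v \<in> cspan ((\<lambda>n. J t (u n)) ` I)"
proof -
  have "v \<in> cspan (u ` I) \<and> J t v \<in> cspan ((\<lambda>n. J t (u n)) ` I)"
    using assms
  proof (rule scaleC.span_induct)
    show "scaleC.subspace {v. v \<in> cspan (u ` I) \<and> J t v \<in> cspan ((\<lambda>n. J t (u n)) ` I)}"
      by (rule scaleC.subspaceI)
        (auto simp: J_0 J_add J_scaleC intro: scaleC.span_zero scaleC.span_add scaleC.span_scale)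
  qed (auto intro: scaleC.span_base)
  then show ?thesis ..
qed

text \<open>Equips every fibre with a dense family whose countable index set is independent of
  \<open>t\<close>, as the supremum formula for the norm requires.\<close>

lemma fibre_eq: "fibre u I J t = closure (rat_comb (\<lambda>n. J t (u n)) ` lists (UNIV \<times> UNIV \<times> I))"
proof
  show "fibre u I J t \<subseteq> closure (rat_comb (\<lambda>n. J t (u n)) ` lists (UNIV \<times> UNIV \<times> I))"
    unfolding fibre_def
    by (intro closure_minimal) (auto dest: J_in_span span_subset_closure_rat_comb)
  have "rat_comb (\<lambda>n. J t (u n)) l \<in> J t ` cspan (u ` I)" if "l \<in> lists (UNIV \<times> UNIV \<times> I)" for l
    using that
  proof (induction l)
    case Nil
    show ?case using J_0 scaleC.span_zero by (metis image_eqI rat_comb_simps(1))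
  next
    case (Cons a l)
    obtain p q n where a: "a = (p, q, n)" by (cases a)
    from Cons obtain v where v: "v \<in> cspan (u ` I)" "rat_comb (\<lambda>n. J t (u n)) l = J t v" by auto
    have n: "u n \<in> cspan (u ` I)" using Cons a by (auto intro: scaleC.span_base)
    show ?case
      using n v by (intro image_eqI [of _ _ "Complex (of_rat p) (of_rat q) *\<^sub>C u n + v"])
        (simp_all add: a J_add J_scaleC scaleC.span_add scaleC.span_scale)
  qed
  then show "closure (rat_comb (\<lambda>n. J t (u n)) ` lists (UNIV \<times> UNIV \<times> I)) \<subseteq> fibre u I J t"
    unfolding fibre_def by (intro closure_mono) auto
qed

lemma fibre_J: "v \<in> cspan (u ` I) \<Longrightarrow> J t v \<in> fibre u I J t"
  unfolding fibre_def by (intro subsetD [OF closure_subset] imageI)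

lemma fibre_0: "0 \<in> fibre u I J t"
  using fibre_J [OF scaleC.span_zero, of t] by (simp add: J_0)

lemma fibre_add:
  assumes "x \<in> fibre u I J t" "y \<in> fibre u I J t"
  shows "x + y \<in> fibre u I J t"
proof -
  obtain a b where ab: "\<And>n. a n \<in> J t ` cspan (u ` I)" "a \<longlonglongrightarrow> x"
    "\<And>n. b n \<in> J t ` cspan (u ` I)" "b \<longlonglongrightarrow> y"
    using assms unfolding fibre_def closure_sequential by metis
  have "a n + b n \<in> J t ` cspan (u ` I)" for n
    using ab(1,3) [of n] by (auto simp: J_add [symmetric] intro!: imageI scaleC.span_add)
  then show ?thesis
    using tendsto_add [OF ab(2,4)] unfolding fibre_def closure_sequential
    by (intro exI [of _ "\<lambda>n. a n + b n"]) simp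
qed

lemma fibre_scaleC:
  assumes "x \<in> fibre u I J t"
  shows "c *\<^sub>C x \<in> fibre u I J t"
proof -
  obtain a where a: "\<And>n. a n \<in> J t ` cspan (u ` I)" "a \<longlonglongrightarrow> x"
    using assms unfolding fibre_def closure_sequential by metis
  have "c *\<^sub>C a n \<in> J t ` cspan (u ` I)" for n
    using a(1) [of n] by (auto simp: J_scaleC [symmetric] intro!: imageI scaleC.span_scale)
  then show ?thesis
    using tendsto_scaleC [OF tendsto_const a(2), of c] unfolding fibre_def closure_sequential
    by (intro exI [of _ "\<lambda>n. c *\<^sub>C a n"]) simp
qed

lemma fieldsI:
  assumes "\<And>t. f t \<in> fibre u I J t"
    and "\<And>n. n \<in> I \<Longrightarrow> (\<lambda>t. cinner (J t (u n)) (f t)) \<in> borel_measurable M"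
  shows "f \<in> fl"
  using assms by (simp add: fields_def)

lemma fieldsD:
  assumes "f \<in> fl"
  shows "f t \<in> fibre u I J t"
    and "n \<in> I \<Longrightarrow> (\<lambda>t. cinner (J t (u n)) (f t)) \<in> borel_measurable M"
  using assms by (simp_all add: fields_def)

lemma fields_add: "f \<in> fl \<Longrightarrow> g \<in> fl \<Longrightarrow> (\<lambda>t. f t + g t) \<in> fl"
  by (intro fieldsI) (simp_all add: cinner_add_right fieldsD fibre_add borel_measurable_add)

lemma fields_mult: "f \<in> fl \<Longrightarrow> c \<in> borel_measurable M \<Longrightarrow> (\<lambda>t. c t *\<^sub>C f t) \<in> fl"
  by (intro fieldsI) (simp_all add: cinner_scaleC_right fieldsD fibre_scaleC borel_measurable_times)

lemma fields_0: "(\<lambda>t. 0) \<in> fl"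
  by (simp add: fields_def fibre_0)

lemma fields_J: "n \<in> I \<Longrightarrow> (\<lambda>t. J t (u n)) \<in> fl"
  by (intro fieldsI borel_measurable_integrable gram_integrable fibre_J scaleC.span_base imageI)

lemma fields_rat_comb:
  "l \<in> lists (UNIV \<times> UNIV \<times> I) \<Longrightarrow> (\<lambda>t. rat_comb (\<lambda>n. J t (u n)) l) \<in> fl"
proof (induction l)
  case (Cons a l)
  obtain p q n where a: "a = (p, q, n)" by (cases a)
  have "(\<lambda>t. Complex (of_rat p) (of_rat q) *\<^sub>C J t (u n) + rat_comb (\<lambda>n. J t (u n)) l) \<in> fl"
    using Cons a by (intro fields_add fields_mult fields_J borel_measurable_const) auto
  then show ?case by (simp add: a)
qed (simp add: fields_0)

lemma measurable_cinner_rat_comb: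
  assumes "f \<in> fl"
  shows "l \<in> lists (UNIV \<times> UNIV \<times> I) \<Longrightarrow>
    (\<lambda>t. cinner (rat_comb (\<lambda>n. J t (u n)) l) (f t)) \<in> borel_measurable M"
proof (induction l)
  case (Cons a l)
  then show ?case
    using fieldsD(2) [OF assms]
    by (cases a) (simp add: cinner_add_left cinner_scaleC_left)
qed simp

text \<open>Membership in \<open>fields\<close> gives measurability only against the generators. The
  squared norm is recovered as a countable supremum of expressions built from such products and from
  the Gram functions.\<close>

lemma measurable_norm2:
  assumes f: "f \<in> fl"
  shows "(\<lambda>t. (norm (f t))\<^sup>2) \<in> borel_measurable M"
proof -
  let ?L = "lists (UNIV \<times> UNIV \<times> I)" and ?v = "\<lambda>t. rat_comb (\<lambda>n. J t (u n))"
  have clos: "f t \<in> closure (?v t ` ?L)" for t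
    using f unfolding fibre_eq [symmetric] by (simp add: fields_def)
  have "(norm (f t))\<^sup>2 = (SUP l\<in>?L. 2 * inner (?v t l) (f t) - (norm (?v t l))\<^sup>2)" for t
    using norm2_eq_SUP_closure(2) [OF clos, of t] by (simp add: image_image)
  moreover have "(\<lambda>t. SUP l\<in>?L. 2 * inner (?v t l) (f t) - (norm (?v t l))\<^sup>2) \<in> borel_measurable M"
  proof (rule borel_measurable_cSUP)
    fix l :: "(rat \<times> rat \<times> nat) list" assume l: "l \<in> ?L"
    have "(\<lambda>t. 2 * Re (cinner (?v t l) (f t)) - Re (cinner (?v t l) (?v t l))) \<in> borel_measurable M"
      using measurable_cinner_rat_comb [OF f l] measurable_cinner_rat_comb [OF fields_rat_comb [OF l] l]
      by (intro borel_measurable_diff borel_measurable_times borel_measurable_const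
          measurable_compose [OF _ borel_measurable_Re])
    then show "(\<lambda>t. 2 * inner (?v t l) (f t) - (norm (?v t l))\<^sup>2) \<in> borel_measurable M"
      unfolding cinner_self Re_complex_of_real inner_eq_Re_cinner .
  next
    show "bdd_above ((\<lambda>l. 2 * inner (?v t l) (f t) - (norm (?v t l))\<^sup>2) ` ?L)" for t
      using norm2_eq_SUP_closure(1) [OF clos, of t] by (simp add: image_image)
  qed simp
  ultimately show ?thesis by simp
qed

text \<open>Polarization of the measurable squared norms gives the real part, and the same for
  \<open>\<i> *\<^sub>C f\<close> gives the imaginary part.\<close>

lemma measurable_cinner:
  assumes f: "f \<in> fl" and g: "g \<in> fl"
  shows "(\<lambda>t. cinner (f t) (g t)) \<in> borel_measurable M"
proof -
  have "(\<lambda>t. inner (f t) (g t)) \<in> borel_measurable M" if "f \<in> fl" "g \<in> fl" for f g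
  proof -
    have "(\<lambda>t. ((norm (f t + g t))\<^sup>2 - (norm (f t))\<^sup>2 - (norm (g t))\<^sup>2) / 2) \<in> borel_measurable M"
      using that by (intro borel_measurable_divide borel_measurable_diff measurable_norm2
          fields_add borel_measurable_const)
    then show ?thesis by (simp add: dot_norm)
  qed
  from this [OF f g] this [OF fields_mult [OF f borel_measurable_const] g]
  have "(\<lambda>t. Complex (inner (f t) (g t)) (inner (\<i> *\<^sub>C f t) (g t))) \<in> borel_measurable M"
    unfolding borel_measurable_complex_iff by simp
  then show ?thesis by (simp add: cinner_expand [symmetric])
qed

section \<open>Weighted square-integrable fields\<close>

lemma sq_fields_iff:
  assumes [measurable]: "w \<in> borel_measurable borel" and w: "\<And>t. 0 \<le> w t"
  shows "f \<in> sq w \<longleftrightarrow> f \<in> fl \<and> integrable M (\<lambda>t. w t * (norm (f t))\<^sup>2)"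
proof (cases "f \<in> fl")
  case True
  have "(\<lambda>t. w t * (norm (f t))\<^sup>2) \<in> borel_measurable M"
    by (intro borel_measurable_times measurable_M measurable_norm2 True) simp
  then show ?thesis
    using True w by (simp add: sq_fields_def wnorm2_def integrable_iff_bounded abs_mult)
qed (simp add: sq_fields_def)

lemma wnorm2_eq_integral:
  assumes "w \<in> borel_measurable borel" "\<And>t. 0 \<le> w t" "f \<in> sq w"
  shows "wnorm2 \<mu> w f = ennreal (LINT t|M. w t * (norm (f t))\<^sup>2)"
  using assms sq_fields_iff [OF assms(1,2)] unfolding wnorm2_def
  by (intro nn_integral_eq_integral) auto

text \<open>One comparison of weights covers constants, indicators, the resolvent factor, its
  inverse and multiplication by \<open>t\<close>.\<close>

lemma sq_fields_mult:
  assumes f: "f \<in> sq w" and w: "w \<in> borel_measurable borel" "\<And>t. 0 \<le> w t"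
    and w': "w' \<in> borel_measurable borel" "\<And>t. 0 \<le> w' t"
    and c: "c \<in> borel_measurable borel" and le: "\<And>t. w' t * (cmod (c t))\<^sup>2 \<le> K * w t"
  shows "(\<lambda>t. c t *\<^sub>C f t) \<in> sq w'"
proof -
  have ffl: "f \<in> fl" and int: "integrable M (\<lambda>t. w t * (norm (f t))\<^sup>2)"
    using f sq_fields_iff [OF w] by auto
  have cf: "(\<lambda>t. c t *\<^sub>C f t) \<in> fl"
    by (intro fields_mult ffl measurable_M c)
  have "integrable M (\<lambda>t. w' t * (norm (c t *\<^sub>C f t))\<^sup>2)"
  proof (rule Bochner_Integration.integrable_bound)
    show "integrable M (\<lambda>t. K * (w t * (norm (f t))\<^sup>2))"
      using int by (rule integrable_mult_right)
    show "(\<lambda>t. w' t * (norm (c t *\<^sub>C f t))\<^sup>2) \<in> borel_measurable M"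
      by (intro borel_measurable_times measurable_M w' measurable_norm2 cf)
    have "w' t * (norm (c t *\<^sub>C f t))\<^sup>2 \<le> K * (w t * (norm (f t))\<^sup>2)" for t
      using mult_right_mono [OF le, of "(norm (f t))\<^sup>2" t]
      by (simp add: norm_scaleC power_mult_distrib mult.assoc)
    then show "AE t in M. norm (w' t * (norm (c t *\<^sub>C f t))\<^sup>2) \<le> norm (K * (w t * (norm (f t))\<^sup>2))"
      using w'(2) by (intro AE_I2)
        (simp only: real_norm_def abs_of_nonneg zero_le_mult_iff order_trans [OF _ abs_ge_self]
          zero_le_power2 simp_thms)
  qed
  then show ?thesis using cf by (simp add: sq_fields_iff [OF w'])
qed

lemma sq_fields_add:
  assumes w: "w \<in> borel_measurable borel" "\<And>t. 0 \<le> w t" and f: "f \<in> sq w" and g: "g \<in> sq w"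
  shows "(\<lambda>t. f t + g t) \<in> sq w"
proof -
  have fl: "f \<in> fl" "g \<in> fl" and int: "integrable M (\<lambda>t. w t * (norm (f t))\<^sup>2)"
      "integrable M (\<lambda>t. w t * (norm (g t))\<^sup>2)"
    using f g sq_fields_iff [OF w] by auto
  have fg: "(\<lambda>t. f t + g t) \<in> fl" by (intro fields_add fl)
  have "integrable M (\<lambda>t. w t * (norm (f t + g t))\<^sup>2)"
  proof (rule Bochner_Integration.integrable_bound)
    show "integrable M (\<lambda>t. 2 * (w t * (norm (f t))\<^sup>2) + 2 * (w t * (norm (g t))\<^sup>2))"
      using int by simp
    show "(\<lambda>t. w t * (norm (f t + g t))\<^sup>2) \<in> borel_measurable M"
      by (intro borel_measurable_times measurable_M w measurable_norm2 fg)
    have "w t * (norm (f t + g t))\<^sup>2 \<le> 2 * (w t * (norm (f t))\<^sup>2) + 2 * (w t * (norm (g t))\<^sup>2)" for t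
    proof -
      have "(norm (f t + g t))\<^sup>2 \<le> (norm (f t) + norm (g t))\<^sup>2"
        by (intro power_mono norm_triangle_ineq) simp
      also have "\<dots> \<le> 2 * (norm (f t))\<^sup>2 + 2 * (norm (g t))\<^sup>2"
        using sum_squares_ge_zero [of "norm (f t) - norm (g t)" 0]
        by (simp add: power2_eq_square algebra_simps)
      finally show ?thesis
        using mult_left_mono [OF _ w(2)] by (fastforce simp: distrib_left mult_ac)
    qed
    then show "AE t in M. norm (w t * (norm (f t + g t))\<^sup>2)
        \<le> norm (2 * (w t * (norm (f t))\<^sup>2) + 2 * (w t * (norm (g t))\<^sup>2))"
      using w(2) by (intro AE_I2) (simp add: abs_mult abs_of_nonneg)
  qed
  then show ?thesis using fg by (simp add: sq_fields_iff [OF w])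
qed

lemma sq_fields_scaleC:
  assumes w: "w \<in> borel_measurable borel" "\<And>t. 0 \<le> w t" and f: "f \<in> sq w"
  shows "(\<lambda>t. c *\<^sub>C f t) \<in> sq w"
  using f by (rule sq_fields_mult [OF _ w w, of f "\<lambda>_. c" "(cmod c)\<^sup>2"]) simp_all

lemma sq_fields_indicator:
  assumes w: "w \<in> borel_measurable borel" "\<And>t. 0 \<le> w t" and f: "f \<in> sq w" and "B \<in> sets borel"
  shows "(\<lambda>t. indicator B t *\<^sub>C f t) \<in> sq w"
  using f assms(4) by (intro sq_fields_mult [OF _ w w, of f "indicator B" 1])
    (auto simp: indicator_def w(2))

lemma sq_fields_0: "(\<lambda>t. 0) \<in> sq w"
  by (simp add: sq_fields_def fields_0 wnorm2_def)

lemma sq_fields_diff: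
  assumes w: "w \<in> borel_measurable borel" "\<And>t. 0 \<le> w t" and f: "f \<in> sq w" and g: "g \<in> sq w"
  shows "(\<lambda>t. f t - g t) \<in> sq w"
  using sq_fields_add [OF w f sq_fields_scaleC [OF w g, of "- 1"]]
  by (simp add: scaleC.scale_minus_left)

text \<open>Cauchy-Schwarz in each fibre bounds the integrand by the sum of the two weighted squared
  norms.\<close>

lemma integrable_cinner_sq_fields:
  assumes w: "w \<in> borel_measurable borel" "\<And>t. 0 \<le> w t" and f: "f \<in> sq w" and g: "g \<in> sq w"
  shows "integrable M (\<lambda>t. complex_of_real (w t) * cinner (f t) (g t))"
proof (rule Bochner_Integration.integrable_bound)
  have fl: "f \<in> fl" "g \<in> fl" and int: "integrable M (\<lambda>t. w t * (norm (f t))\<^sup>2)"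
      "integrable M (\<lambda>t. w t * (norm (g t))\<^sup>2)"
    using f g sq_fields_iff [OF w] by auto
  show "integrable M (\<lambda>t. w t * (norm (f t))\<^sup>2 + w t * (norm (g t))\<^sup>2)"
    using int by simp
  show "(\<lambda>t. complex_of_real (w t) * cinner (f t) (g t)) \<in> borel_measurable M"
    using measurable_M [OF w(1)] measurable_cinner [OF fl]
    by measurable
  have "norm (complex_of_real (w t) * cinner (f t) (g t))
      \<le> w t * (norm (f t))\<^sup>2 + w t * (norm (g t))\<^sup>2" for t
  proof -
    have "2 * (norm (f t) * norm (g t)) \<le> (norm (f t))\<^sup>2 + (norm (g t))\<^sup>2"
      using sum_squares_ge_zero [of "norm (f t) - norm (g t)" 0]
      by (simp add: power2_eq_square algebra_simps)
    moreover have "0 \<le> norm (f t) * norm (g t)" by simp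
    ultimately have "cmod (cinner (f t) (g t)) \<le> (norm (f t))\<^sup>2 + (norm (g t))\<^sup>2"
      using cmod_cinner_le [of "f t" "g t"] by linarith
    then show ?thesis
      using mult_left_mono [OF _ w(2)] w(2) by (simp add: norm_mult distrib_left [symmetric])
  qed
  then show "AE t in M. norm (complex_of_real (w t) * cinner (f t) (g t))
      \<le> norm (w t * (norm (f t))\<^sup>2 + w t * (norm (g t))\<^sup>2)"
    by (intro AE_I2) (simp add: order_trans [OF _ abs_ge_self])
qed

lemma ae_class_eq_iff:
  assumes "f \<in> fl" "g \<in> fl"
  shows "cls f = cls g \<longleftrightarrow> (AE t in \<mu>. f t = g t)"
proof
  assume "cls f = cls g"
  moreover have "f \<in> cls f" using assms by (simp add: ae_class_def)
  ultimately show "AE t in \<mu>. f t = g t" by (simp add: ae_class_def)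
next
  assume fg: "AE t in \<mu>. f t = g t"
  have "(AE t in \<mu>. h t = f t) \<longleftrightarrow> (AE t in \<mu>. h t = g t)" for h
  proof
    assume "AE t in \<mu>. h t = f t"
    with fg show "AE t in \<mu>. h t = g t" by eventually_elim simp
  next
    assume "AE t in \<mu>. h t = g t"
    with fg show "AE t in \<mu>. h t = f t" by eventually_elim simp
  qed
  then show "cls f = cls g" by (simp add: ae_class_def)
qed

lemma J_sq_fields: "n \<in> I \<Longrightarrow> (\<lambda>t. J t (u n)) \<in> sq (\<lambda>_. 1)"
proof -
  assume n: "n \<in> I"
  have "integrable M (\<lambda>t. Re (cinner (J t (u n)) (J t (u n))))"
    by (intro integrable_Re gram_integrable n)
  then show ?thesis
    using fields_J [OF n] by (subst sq_fields_iff) (simp_all add: cinner_self flip: of_real_power)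
qed

lemma one_plus_square: "(\<lambda>t::real. 1 + t\<^sup>2) \<in> borel_measurable borel" "0 \<le> 1 + (t::real)\<^sup>2"
  by simp_all

lemma one_plus_square2:
  "(\<lambda>t::real. (1 + t\<^sup>2) * (1 + t\<^sup>2)) \<in> borel_measurable borel"
  "0 \<le> (1 + (t::real)\<^sup>2) * (1 + t\<^sup>2)"
  by simp_all

lemma cmod_of_real_minus_i: "(cmod (of_real t - \<i>))\<^sup>2 = 1 + t\<^sup>2"
  by (simp add: cmod_power2)

text \<open>The resolvent factor has squared modulus \<open>1 / (1 + t^2)\<close> and so exactly
  offsets the weight.\<close>

lemma resolvent_sq_fields:
  assumes "g \<in> sq (\<lambda>_. 1)"
  shows "(\<lambda>t. inverse (complex_of_real t - \<i>) *\<^sub>C g t) \<in> sq (\<lambda>t. 1 + t\<^sup>2)"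
proof (rule sq_fields_mult [OF assms _ _ one_plus_square, where K = 1])
  show "(1 + t\<^sup>2) * (cmod (inverse (complex_of_real t - \<i>)))\<^sup>2 \<le> 1 * 1" for t
    unfolding norm_inverse power_inverse cmod_of_real_minus_i
    by (simp add: right_inverse add_nonneg_eq_0_iff)
qed simp_all

lemma uu_sq_fields: "n \<in> I \<Longrightarrow> uu u J n \<in> sq (\<lambda>t. 1 + t\<^sup>2)"
  unfolding uu_def [abs_def] by (intro resolvent_sq_fields J_sq_fields)

text \<open>The integrals over all Borel sets determine \<open>cinner (J t (u n)) (f t)\<close> for almost
  every \<open>t\<close>, and the \<open>J t (u n)\<close> are total in the fibre.\<close>

lemma AE_eq_0_if_orthogonal_indicator_uu:
  assumes f: "f \<in> sq (\<lambda>t. 1 + t\<^sup>2)"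
    and 0: "\<And>B n. B \<in> sets borel \<Longrightarrow> n \<in> I \<Longrightarrow>
      (LINT t|M. complex_of_real (1 + t\<^sup>2) * cinner (indicator B t *\<^sub>C uu u J n t) (f t)) = 0"
  shows "AE t in \<mu>. f t = 0"
proof -
  have "AE t in \<mu>. cinner (J t (u n)) (f t) = 0" if n: "n \<in> I" for n
  proof -
    have "AE t in \<mu>. complex_of_real (1 + t\<^sup>2) * cinner (uu u J n t) (f t) = 0"
    proof (rule AE_eq_0_completion [OF sigma_finite])
      show "integrable M (\<lambda>t. complex_of_real (1 + t\<^sup>2) * cinner (uu u J n t) (f t))"
        by (rule integrable_cinner_sq_fields [OF one_plus_square uu_sq_fields [OF n] f])
      fix B assume "B \<in> sets \<mu>"
      then have "B \<in> sets borel" by (simp add: sets_mu)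
      from 0 [OF this n]
      show "(LINT t|M. indicator B t *\<^sub>R (complex_of_real (1 + t\<^sup>2) * cinner (uu u J n t) (f t))) = 0"
        by (rule trans [rotated]) (auto simp: cinner_scaleC_left indicator_def intro!: Bochner_Integration.integral_cong)
    qed
    then show ?thesis
    proof eventually_elim
      case (elim t)
      \<comment> \<open>Neither the weight nor the conjugated resolvent factor in \<open>uu\<close>
        vanishes for real \<open>t\<close>, so both can be cancelled.\<close>
      have "complex_of_real (1 + t\<^sup>2) \<noteq> 0" "complex_of_real t \<noteq> \<i>" "complex_of_real t + \<i> \<noteq> 0"
        by (auto simp: complex_eq_iff add_nonneg_eq_0_iff)
      then show ?case
        using elim by (simp add: uu_def cinner_scaleC_left)
    qed
  qed
  \<comment> \<open>As \<open>I\<close> is countable, one null set serves all generators.\<close>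
  then have "AE t in \<mu>. \<forall>n\<in>I. cinner (J t (u n)) (f t) = 0"
    by (intro AE_ball_countable') auto
  then show ?thesis
  proof eventually_elim
    case (elim t)
    have "cinner v (f t) = 0" if "v \<in> cspan ((\<lambda>n. J t (u n)) ` I)" for v
      using that elim
      by (induction rule: scaleC.span_induct_alt) (auto simp: cinner_add_left cinner_scaleC_left)
    then have "f t \<in> ortho (J t ` cspan (u ` I))"
      by (auto simp: ortho_def dest: J_in_span)
    then have "f t \<in> ortho (fibre u I J t)"
      unfolding fibre_def by (rule ortho_closure)
    moreover have "f t \<in> fibre u I J t"
      using f by (simp add: sq_fields_def fieldsD)
    ultimately have "cinner (f t) (f t) = 0" by (simp add: ortho_def)
    then show ?case by (simp add: cinner_self)
  qed
qed

end

section \<open>The model operators\<close>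

locale fibre_model = measurable_fibres u I J \<mu>
  for u :: "nat \<Rightarrow> 'a::complex_hilbert_space" and I :: "nat set"
    and J :: "real \<Rightarrow> 'a \<Rightarrow> 'k::complex_hilbert_space" and \<mu> :: "real measure" +
  fixes E :: "real set \<Rightarrow> 'a \<Rightarrow> 'a" and U :: "(real \<Rightarrow> 'k) set \<Rightarrow> 'a"
  assumes pvm: "projection_valued_measure E"
    and model: "model_unitary E u I J \<mu> U"
begin

abbreviation sqW where "sqW \<equiv> sq (\<lambda>t. 1 + t\<^sup>2)"
abbreviation sqW2 where "sqW2 \<equiv> sq (\<lambda>t. (1 + t\<^sup>2) * (1 + t\<^sup>2))"

section \<open>Elementary properties of \<open>U\<close>\<close>

lemma L2: "L2_unitary u I J \<mu> (\<lambda>t. 1 + t\<^sup>2) U"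
  using model by (simp add: model_unitary_def)

lemma U_add: "f \<in> sqW \<Longrightarrow> g \<in> sqW \<Longrightarrow> U (cls (\<lambda>t. f t + g t)) = U (cls f) + U (cls g)"
  using L2 by (simp add: L2_unitary_def)

lemma U_scaleC: "f \<in> sqW \<Longrightarrow> U (cls (\<lambda>t. c *\<^sub>C f t)) = c *\<^sub>C U (cls f)"
  using L2 by (simp add: L2_unitary_def)

lemma U_0: "U (cls (\<lambda>t. 0)) = 0"
  using U_scaleC [OF sq_fields_0, of 0] by simp

lemma cinner_U: "f \<in> sqW \<Longrightarrow> g \<in> sqW \<Longrightarrow> cinner (U (cls f)) (U (cls g)) =
    (LINT t|M. complex_of_real (1 + t\<^sup>2) * cinner (f t) (g t))"
  using L2 by (simp add: L2_unitary_def)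

lemma U_surj: obtains f where "f \<in> sqW" "x = U (cls f)"
proof -
  have "x \<in> U ` L2_fields u I J \<mu> (\<lambda>t. 1 + t\<^sup>2)"
    using L2 by (simp add: L2_unitary_def)
  then show thesis
    using that by (auto simp: L2_fields_def)
qed

lemma U_diff:
  assumes "f \<in> sqW" "g \<in> sqW"
  shows "U (cls (\<lambda>t. f t - g t)) = U (cls f) - U (cls g)"
  using U_add [OF assms(1) sq_fields_scaleC [OF one_plus_square assms(2), of "- 1"]]
    U_scaleC [OF assms(2), of "- 1"]
  by (simp add: scaleC.scale_minus_left)

lemma sqW_in_fields: "f \<in> sqW \<Longrightarrow> f \<in> fl"
  by (simp add: sq_fields_def)

lemma integrable_sqW: "f \<in> sqW \<Longrightarrow> integrable M (\<lambda>t. (1 + t\<^sup>2) * (norm (f t))\<^sup>2)"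
  by (simp add: sq_fields_iff [OF one_plus_square])

lemma measurable_sqW:
  assumes "f \<in> sqW"
  shows "(\<lambda>t. (1 + t\<^sup>2) * (norm (f t))\<^sup>2) \<in> borel_measurable M"
    and "(\<lambda>t. ennreal ((1 + t\<^sup>2) * (norm (f t))\<^sup>2)) \<in> borel_measurable M"
  using borel_measurable_integrable [OF integrable_sqW [OF assms]]
  by (auto intro: measurable_compose [OF _ measurable_ennreal])

lemma norm_U:
  assumes "f \<in> sqW"
  shows "(norm (U (cls f)))\<^sup>2 = (LINT t|M. (1 + t\<^sup>2) * (norm (f t))\<^sup>2)"
proof -
  have "complex_of_real ((norm (U (cls f)))\<^sup>2)
      = (LINT t|M. complex_of_real ((1 + t\<^sup>2) * (norm (f t))\<^sup>2))"
    unfolding cinner_self [symmetric] cinner_U [OF assms assms]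
    by (simp only: cinner_self of_real_mult)
  then show ?thesis
    unfolding integral_complex_of_real of_real_eq_iff .
qed

lemma wnorm2_U: "f \<in> sqW \<Longrightarrow> wnorm2 \<mu> (\<lambda>t. 1 + t\<^sup>2) f = ennreal ((norm (U (cls f)))\<^sup>2)"
  by (simp only: wnorm2_eq_integral [OF one_plus_square] norm_U)

lemma U_eq_0_imp:
  assumes "f \<in> sqW" "U (cls f) = 0"
  shows "AE t in \<mu>. f t = 0"
proof -
  have "wnorm2 \<mu> (\<lambda>t. 1 + t\<^sup>2) f = 0"
    using wnorm2_U [OF assms(1)] assms(2) by simp
  then have "AE t in M. ennreal ((1 + t\<^sup>2) * (norm (f t))\<^sup>2) = 0"
    unfolding wnorm2_def nn_integral_0_iff_AE [OF measurable_sqW(2) [OF assms(1)]] .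
  then have "AE t in \<mu>. ennreal ((1 + t\<^sup>2) * (norm (f t))\<^sup>2) = 0"
    by (simp only: AE_completion_iff)
  then show ?thesis
  proof eventually_elim
    case (elim t)
    have "1 + t\<^sup>2 > 0" by (simp add: add_pos_nonneg)
    then show ?case using elim by (simp add: ennreal_eq_0_iff mult_le_0_iff)
  qed
qed

lemma U_eq_iff:
  assumes "f \<in> sqW" "g \<in> sqW"
  shows "U (cls f) = U (cls g) \<longleftrightarrow> (AE t in \<mu>. f t = g t)"
proof
  assume "U (cls f) = U (cls g)"
  then have "AE t in \<mu>. f t - g t = 0"
    using assms by (intro U_eq_0_imp sq_fields_diff one_plus_square) (simp_all add: U_diff)
  then show "AE t in \<mu>. f t = g t" by simp
next
  assume "AE t in \<mu>. f t = g t"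
  then show "U (cls f) = U (cls g)"
    using ae_class_eq_iff assms sqW_in_fields by metis
qed

lemma U_indicator_uu:
  assumes "B \<in> sets borel" "n \<in> I"
  shows "U (cls (\<lambda>t. indicator B t *\<^sub>C uu u J n t)) = E B (u n)"
proof -
  have "\<forall>S \<alpha>. finite S \<longrightarrow> S \<subseteq> sets borel \<times> I \<longrightarrow>
        U (cls (\<lambda>t. \<Sum>(B, n)\<in>S. (\<alpha> B n * indicator B t) *\<^sub>C uu u J n t)) =
          (\<Sum>(B, n)\<in>S. \<alpha> B n *\<^sub>C E B (u n))"
    using model by (simp add: model_unitary_def)
  from this [rule_format, of "{(B, n)}" "\<lambda>_ _. 1"] show ?thesis
    using assms by simp
qed

section \<open>The spectral measure in the model space\<close>

text \<open>By surjectivity the difference of the two sides is the image of some field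
  \<open>h\<close>. Self-adjointness of \<open>E C\<close> and multiplicativity of \<open>E\<close>
  make it orthogonal to every \<open>E B (u n)\<close>, so \<open>h\<close> is orthogonal to all
  indicator multiples of the \<open>uu\<close> fields and vanishes almost everywhere.\<close>

lemma E_U:
  assumes f: "f \<in> sqW" and C: "C \<in> sets borel"
  shows "E C (U (cls f)) = U (cls (\<lambda>t. indicator C t *\<^sub>C f t))"
proof -
  have fC: "(\<lambda>t. indicator C t *\<^sub>C f t) \<in> sqW"
    by (rule sq_fields_indicator [OF one_plus_square f C])
  obtain h where h: "h \<in> sqW" "E C (U (cls f)) - U (cls (\<lambda>t. indicator C t *\<^sub>C f t)) = U (cls h)"
    using U_surj .
  have "AE t in \<mu>. h t = 0"
  proof (rule AE_eq_0_if_orthogonal_indicator_uu [OF h(1)])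
    fix B n assume B: "B \<in> sets (borel :: real measure)" and n: "n \<in> I"
    have uuB: "(\<lambda>t. indicator B' t *\<^sub>C uu u J n t) \<in> sqW" if "B' \<in> sets borel" for B'
      by (rule sq_fields_indicator [OF one_plus_square uu_sq_fields [OF n] that])
    have CB: "C \<inter> B \<in> sets borel" using B C by auto
    have "cinner (E B (u n)) (E C (U (cls f))) = cinner (E C (E B (u n))) (U (cls f))"
      using pvm C by (simp add: projection_valued_measure_def is_orth_projection_def)
    also have "E C (E B (u n)) = E (C \<inter> B) (u n)"
      using pvm B C by (simp add: projection_valued_measure_def)
    also have "cinner (E (C \<inter> B) (u n)) (U (cls f))
        = (LINT t|M. complex_of_real (1 + t\<^sup>2) * cinner (indicator (C \<inter> B) t *\<^sub>C uu u J n t) (f t))"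
      unfolding U_indicator_uu [OF CB n, symmetric] by (rule cinner_U [OF uuB [OF CB] f])
    also have "\<dots> = (LINT t|M. complex_of_real (1 + t\<^sup>2)
        * cinner (indicator B t *\<^sub>C uu u J n t) (indicator C t *\<^sub>C f t))"
      by (rule Bochner_Integration.integral_cong)
        (simp_all add: indicator_def cinner_scaleC_left cinner_scaleC_right)
    also have "\<dots> = cinner (E B (u n)) (U (cls (\<lambda>t. indicator C t *\<^sub>C f t)))"
      unfolding U_indicator_uu [OF B n, symmetric] by (rule cinner_U [OF uuB [OF B] fC, symmetric])
    finally have "cinner (E B (u n)) (U (cls h)) = 0"
      by (simp add: h(2) [symmetric] cinner_diff_right)
    then show "(LINT t|M. complex_of_real (1 + t\<^sup>2) * cinner (indicator B t *\<^sub>C uu u J n t) (h t)) = 0"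
      by (simp only: cinner_U [OF uuB [OF B] h(1), symmetric] U_indicator_uu [OF B n])
  qed
  then have "U (cls h) = 0"
    using U_eq_iff [OF h(1) sq_fields_0] U_0 by simp
  then show ?thesis using h(2) by simp
qed

text \<open>By \<open>E_U\<close> the right-hand measure gives a Borel set \<open>B\<close> the mass
  \<open>(norm (E B (U (cls f))))^2\<close>, so both sides have the same distribution function. The
  \<open>distr\<close> along the identity merely restricts the completed sigma-algebra to the Borel
  sets.\<close>

lemma interval_measure_eq:
  assumes f: "f \<in> sqW"
  shows "interval_measure (\<lambda>t. (norm (E {..t} (U (cls f))))\<^sup>2)
    = distr (density M (\<lambda>t. ennreal ((1 + t\<^sup>2) * (norm (f t))\<^sup>2))) borel (\<lambda>t. t)"
    (is "interval_measure ?G = ?\<nu>")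
proof -
  let ?r = "\<lambda>t. (1 + t\<^sup>2) * (norm (f t))\<^sup>2"
  have r: "(\<lambda>t. ennreal (?r t)) \<in> borel_measurable M"
    by (rule measurable_sqW [OF f])
  have id: "(\<lambda>t. t) \<in> borel_measurable (density M (\<lambda>t. ennreal (?r t)))"
    using measurable_M [of "\<lambda>t. t"] by simp
  have em: "emeasure ?\<nu> B = ennreal ((norm (E B (U (cls f))))\<^sup>2)" if B: "B \<in> sets borel" for B
  proof -
    have fB: "(\<lambda>t. indicator B t *\<^sub>C f t) \<in> sqW"
      by (rule sq_fields_indicator [OF one_plus_square f B])
    have "emeasure ?\<nu> B = (\<integral>\<^sup>+ t. ennreal (?r t) * indicator B t \<partial>M)"
      using B id r by (simp add: emeasure_distr emeasure_density sets_M_borel)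
    also have "\<dots> = wnorm2 \<mu> (\<lambda>t. 1 + t\<^sup>2) (\<lambda>t. indicator B t *\<^sub>C f t)"
      unfolding wnorm2_def by (intro nn_integral_cong) (simp add: indicator_def)
    also have "\<dots> = ennreal ((norm (E B (U (cls f))))\<^sup>2)"
      by (simp only: wnorm2_U [OF fB] E_U [OF f B])
    finally show ?thesis .
  qed
  interpret \<nu>: finite_borel_measure ?\<nu>
    by (intro finite_borel_measure.intro finite_measureI finite_borel_measure_axioms.intro)
      (simp_all add: em)
  have G: "?G = cdf ?\<nu>"
    by (simp add: cdf_def measure_def em fun_eq_iff)
  have "interval_measure (cdf ?\<nu>) = ?\<nu>"
  proof (rule cdf_unique')
    show "finite_borel_measure (interval_measure (cdf ?\<nu>))"
      by (rule finite_borel_measure_interval_measure [OF \<nu>.cdf_nondecreasing \<nu>.cdf_is_right_cont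
            \<nu>.cdf_lim_at_bot \<nu>.cdf_lim_at_top]) simp_all
    show "cdf (interval_measure (cdf ?\<nu>)) = cdf ?\<nu>"
      by (rule cdf_interval_measure [OF \<nu>.cdf_nondecreasing \<nu>.cdf_is_right_cont \<nu>.cdf_lim_at_bot])
  qed (rule \<nu>.finite_borel_measure_axioms)
  then show ?thesis unfolding G .
qed

lemma interval_measure_integral:
  fixes g :: "real \<Rightarrow> real"
  assumes f: "f \<in> sqW" and g: "g \<in> borel_measurable borel"
  shows "integrable (interval_measure (\<lambda>t. (norm (E {..t} (U (cls f))))\<^sup>2)) g
      \<longleftrightarrow> integrable M (\<lambda>t. (1 + t\<^sup>2) * (norm (f t))\<^sup>2 * g t)"
    and "(LINT t|interval_measure (\<lambda>t. (norm (E {..t} (U (cls f))))\<^sup>2). g t)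
      = (LINT t|M. (1 + t\<^sup>2) * (norm (f t))\<^sup>2 * g t)"
proof -
  let ?r = "\<lambda>t. (1 + t\<^sup>2) * (norm (f t))\<^sup>2"
  have r: "?r \<in> borel_measurable M"
    by (rule measurable_sqW [OF f])
  have id: "(\<lambda>t. t) \<in> borel_measurable (density M (\<lambda>t. ennreal (?r t)))"
    using measurable_M [of "\<lambda>t. t"] by simp
  have gM: "g \<in> borel_measurable M" by (rule measurable_M [OF g])
  show "integrable (interval_measure (\<lambda>t. (norm (E {..t} (U (cls f))))\<^sup>2)) g
      \<longleftrightarrow> integrable M (\<lambda>t. (1 + t\<^sup>2) * (norm (f t))\<^sup>2 * g t)"
    unfolding interval_measure_eq [OF f] integrable_distr_eq [OF id g]
    by (subst integrable_density [OF gM r]) simp_all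
  show "(LINT t|interval_measure (\<lambda>t. (norm (E {..t} (U (cls f))))\<^sup>2). g t)
      = (LINT t|M. (1 + t\<^sup>2) * (norm (f t))\<^sup>2 * g t)"
    unfolding interval_measure_eq [OF f] integral_distr [OF id g]
    by (subst integral_density [OF gM r]) simp_all
qed

section \<open>Multiplication by \<open>t\<close> transported by \<open>U\<close>\<close>

lemma sqW2_imp_sqW:
  assumes "f \<in> sqW2"
  shows "f \<in> sqW"
proof -
  have "(\<lambda>t. 1 *\<^sub>C f t) \<in> sqW"
  proof (rule sq_fields_mult [OF assms one_plus_square2 one_plus_square, where K = 1])
    show "(1 + t\<^sup>2) * (cmod 1)\<^sup>2 \<le> 1 * ((1 + t\<^sup>2) * (1 + t\<^sup>2))" for t :: real
      using mult_left_mono [of 1 "1 + t\<^sup>2" "1 + t\<^sup>2"] by simp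
  qed simp
  then show ?thesis by simp
qed

lemma mult_sqW2:
  assumes "f \<in> sqW2"
  shows "(\<lambda>t. complex_of_real t *\<^sub>C f t) \<in> sqW"
proof (rule sq_fields_mult [OF assms one_plus_square2 one_plus_square, where K = 1])
  show "(1 + t\<^sup>2) * (cmod (complex_of_real t))\<^sup>2 \<le> 1 * ((1 + t\<^sup>2) * (1 + t\<^sup>2))" for t :: real
    by (simp add: mult_left_mono)
qed simp

text \<open>The weight splits as \<open>(1 + t^2) + (1 + t^2) * t^2\<close>. The first summand is
  integrable against \<open>(norm (f t))^2\<close> already; the second gives the domain condition of
  \<open>spectral_family\<close>.\<close>

lemma sqW2_iff:
  assumes f: "f \<in> sqW"
  shows "f \<in> sqW2 \<longleftrightarrow> integrable M (\<lambda>t. (1 + t\<^sup>2) * (norm (f t))\<^sup>2 * t\<^sup>2)"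
proof -
  let ?r = "\<lambda>t. (1 + t\<^sup>2) * (norm (f t))\<^sup>2"
  have fl: "f \<in> fl" and int: "integrable M ?r"
    using f by (simp_all add: sqW_in_fields integrable_sqW)
  have eq: "(1 + t\<^sup>2) * (1 + t\<^sup>2) * (norm (f t))\<^sup>2 = ?r t + ?r t * t\<^sup>2" for t
    by (simp add: algebra_simps)
  have "integrable M (\<lambda>t. ?r t + ?r t * t\<^sup>2) \<longleftrightarrow> integrable M (\<lambda>t. ?r t * t\<^sup>2)"
    using Bochner_Integration.integrable_diff [OF _ int, of "\<lambda>t. ?r t + ?r t * t\<^sup>2"]
      Bochner_Integration.integrable_add [OF int, of "\<lambda>t. ?r t * t\<^sup>2"] by auto
  then show ?thesis
    using fl by (simp only: sq_fields_iff [OF one_plus_square2] eq simp_thms)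
qed

lemma conjugate_model_H:
  "conjugate_op U (model_H u I J \<mu>)
    = {(U (cls f), U (cls (\<lambda>t. complex_of_real t *\<^sub>C f t))) | f. f \<in> sqW2}"
  by (auto simp: conjugate_op_def model_H_def)

text \<open>Single-valuedness comes from \<open>U_eq_iff\<close>: two fields representing one vector
  agree almost everywhere, and so do their multiples by \<open>t\<close>.\<close>

lemma linear_operator_conjugate_model_H: "linear_operator (conjugate_op U (model_H u I J \<mu>))"
  (is "linear_operator ?A")
  unfolding linear_operator_def
proof (intro conjI allI impI)
  show "single_valued ?A"
  proof (rule single_valuedI)
    fix x y z assume "(x, y) \<in> ?A" "(x, z) \<in> ?A"
    then obtain f g where fg: "f \<in> sqW2" "g \<in> sqW2" "x = U (cls f)" "x = U (cls g)"
      and yz: "y = U (cls (\<lambda>t. complex_of_real t *\<^sub>C f t))" "z = U (cls (\<lambda>t. complex_of_real t *\<^sub>C g t))"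
      by (auto simp: conjugate_model_H)
    then have "AE t in \<mu>. f t = g t"
      using U_eq_iff [OF fg(1,2) [THEN sqW2_imp_sqW]] by simp
    then have "AE t in \<mu>. complex_of_real t *\<^sub>C f t = complex_of_real t *\<^sub>C g t"
      by eventually_elim simp
    then show "y = z"
      unfolding yz by (subst U_eq_iff) (intro mult_sqW2 fg)+
  qed
  have 0: "(\<lambda>t. 0) \<in> sqW2" by (rule sq_fields_0)
  then show "(0, 0) \<in> ?A"
    unfolding conjugate_model_H using U_0 by (intro CollectI exI [of _ "\<lambda>t. 0"]) simp
next
  fix x y x' y' assume "(x, y) \<in> ?A" "(x', y') \<in> ?A"
  then obtain f g where fg: "f \<in> sqW2" "g \<in> sqW2" "x = U (cls f)" "x' = U (cls g)"
    and yz: "y = U (cls (\<lambda>t. complex_of_real t *\<^sub>C f t))" "y' = U (cls (\<lambda>t. complex_of_real t *\<^sub>C g t))"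
    by (auto simp: conjugate_model_H)
  have "(\<lambda>t. f t + g t) \<in> sqW2"
    by (rule sq_fields_add [OF one_plus_square2 fg(1,2)])
  moreover have "x + x' = U (cls (\<lambda>t. f t + g t))"
    unfolding fg by (rule U_add [symmetric]) (intro sqW2_imp_sqW fg)+
  moreover have "y + y' = U (cls (\<lambda>t. complex_of_real t *\<^sub>C (f t + g t)))"
    unfolding yz scaleC_add_right by (rule U_add [symmetric]) (intro mult_sqW2 fg)+
  ultimately show "(x + x', y + y') \<in> ?A"
    unfolding conjugate_model_H by blast
next
  fix c x y assume "(x, y) \<in> ?A"
  then obtain f where f: "f \<in> sqW2" "x = U (cls f)" "y = U (cls (\<lambda>t. complex_of_real t *\<^sub>C f t))"
    by (auto simp: conjugate_model_H)
  have "(\<lambda>t. c *\<^sub>C f t) \<in> sqW2"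
    by (rule sq_fields_scaleC [OF one_plus_square2 f(1)])
  moreover have "c *\<^sub>C x = U (cls (\<lambda>t. c *\<^sub>C f t))"
    unfolding f by (rule U_scaleC [symmetric]) (intro sqW2_imp_sqW f)
  moreover have "c *\<^sub>C y = U (cls (\<lambda>t. complex_of_real t *\<^sub>C c *\<^sub>C f t))"
    using U_scaleC [OF mult_sqW2 [OF f(1)], of c] unfolding f
    by (simp add: scaleC_scaleC mult.commute)
  ultimately show "(c *\<^sub>C x, c *\<^sub>C y) \<in> ?A"
    unfolding conjugate_model_H by blast
qed

text \<open>Under \<open>interval_measure_integral\<close> the second-moment condition on the domain
  becomes membership in \<open>sqW2\<close>, and the first moment becomes the quadratic form of
  multiplication by \<open>t\<close>.\<close>

lemma self_adjoint_eq_conjugate_model_H: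
  assumes "self_adjoint_op H" and F: "spectral_family H F" and EF: "\<And>t. E {..t} = F t"
  shows "H = conjugate_op U (model_H u I J \<mu>)" (is "H = ?A")
proof (rule linear_operator_eqI_quadratic_form)
  show "linear_operator H" "densely_defined H"
    using assms(1) by (simp_all add: self_adjoint_op_def)
  show "linear_operator ?A" by (rule linear_operator_conjugate_model_H)
  have dom: "U (cls f) \<in> Domain H \<longleftrightarrow> f \<in> sqW2" if "f \<in> sqW" for f
  proof -
    have "U (cls f) \<in> Domain H \<longleftrightarrow>
        integrable (interval_measure (\<lambda>t. (norm (E {..t} (U (cls f))))\<^sup>2)) (\<lambda>t. t\<^sup>2)"
      using F by (simp add: spectral_family_def EF)
    then show ?thesis
      by (simp add: interval_measure_integral(1) [OF that] sqW2_iff [OF that])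
  qed
  show "Domain H = Domain ?A"
  proof (intro equalityI subsetI)
    fix x assume "x \<in> Domain H"
    moreover obtain f where "f \<in> sqW" "x = U (cls f)" by (rule U_surj)
    ultimately show "x \<in> Domain ?A"
      using dom unfolding conjugate_model_H by blast
  next
    fix x assume "x \<in> Domain ?A"
    then obtain f where "f \<in> sqW2" "x = U (cls f)"
      by (auto simp: conjugate_model_H)
    then show "x \<in> Domain H"
      using dom sqW2_imp_sqW by blast
  qed
  fix x y z assume xy: "(x, y) \<in> H" and "(x, z) \<in> ?A"
  then obtain f where f: "f \<in> sqW2" "x = U (cls f)" "z = U (cls (\<lambda>t. complex_of_real t *\<^sub>C f t))"
    by (auto simp: conjugate_model_H)
  have fW: "f \<in> sqW" by (rule sqW2_imp_sqW [OF f(1)])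
  have "cinner x y = complex_of_real (LINT t|interval_measure (\<lambda>t. (norm (E {..t} x))\<^sup>2). t)"
    using F xy by (auto simp: spectral_family_def EF)
  also have "\<dots> = (LINT t|M. complex_of_real ((1 + t\<^sup>2) * (norm (f t))\<^sup>2 * t))"
    unfolding f(2) integral_complex_of_real
    by (rule arg_cong [OF interval_measure_integral(2) [OF fW]]) simp
  also have "\<dots> = (LINT t|M. complex_of_real (1 + t\<^sup>2) * cinner (f t) (complex_of_real t *\<^sub>C f t))"
    by (intro Bochner_Integration.integral_cong refl)
      (simp only: cinner_scaleC_right cinner_self of_real_mult mult_ac)
  also have "\<dots> = cinner x z"
    unfolding f by (rule cinner_U [symmetric, OF fW mult_sqW2 [OF f(1)]])
  finally show "cinner x y = cinner x z" .
qed

section \<open>The map Lambda and the restricted model operator\<close>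

text \<open>On \<open>N\<close> the inverse of \<open>U\<close> is \<open>R \<circ> \<Lambda>\<close>.\<close>

definition R :: "(real \<Rightarrow> 'k) \<Rightarrow> real \<Rightarrow> 'k" where
  "R g t = inverse (complex_of_real t - \<i>) *\<^sub>C g t"

lemma R_sqW: "g \<in> sq (\<lambda>_. 1) \<Longrightarrow> R g \<in> sqW"
  unfolding R_def [abs_def] by (rule resolvent_sq_fields)

text \<open>\<open>R\<close> is isometric from the weight \<open>1\<close> to the weight
  \<open>1 + t^2\<close>. Composed with \<open>U\<close>, it turns unweighted norms of fields into
  norms of vectors.\<close>

lemma wnorm2_R:
  assumes "g \<in> sq (\<lambda>_. 1)"
  shows "wnorm2 \<mu> (\<lambda>_. 1) g = ennreal ((norm (U (cls (R g))))\<^sup>2)"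
proof -
  have "1 * (norm (g t))\<^sup>2 = (1 + t\<^sup>2) * (norm (R g t))\<^sup>2" for t
  proof -
    have "1 + t\<^sup>2 \<noteq> 0" by (simp add: add_nonneg_eq_0_iff)
    then show ?thesis
      unfolding R_def norm_scaleC power_mult_distrib norm_inverse power_inverse cmod_of_real_minus_i
      by simp
  qed
  then have "wnorm2 \<mu> (\<lambda>_. 1) g = wnorm2 \<mu> (\<lambda>t. 1 + t\<^sup>2) (R g)"
    unfolding wnorm2_def by presburger
  then show ?thesis by (simp only: wnorm2_U [OF R_sqW [OF assms]])
qed

text \<open>For a generator, \<open>R\<close> produces \<open>uu u J n\<close>, the indicator field
  of the whole line, which \<open>U\<close> maps to \<open>E UNIV (u n) = u n\<close>. Linearity
  extends this to the span.\<close>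

lemma R_J_span:
  assumes "v \<in> cspan (u ` I)"
  shows "(\<lambda>t. J t v) \<in> sq (\<lambda>_. 1)" "U (cls (R (\<lambda>t. J t v))) = v"
proof -
  let ?P = "\<lambda>v. v \<in> cspan (u ` I) \<and> (\<lambda>t. J t v) \<in> sq (\<lambda>_. 1) \<and> U (cls (R (\<lambda>t. J t v))) = v"
  have w: "(\<lambda>_. 1::real) \<in> borel_measurable borel" "0 \<le> (1::real)" by simp_all
  have "?P v"
    using assms
  proof (rule scaleC.span_induct)
    show "scaleC.subspace {v. ?P v}"
    proof (rule scaleC.subspaceI)
      show "0 \<in> {v. ?P v}"
        by (simp add: U_0 J_0 R_def [abs_def] sq_fields_0 scaleC.span_zero)
    next
      fix x y assume "x \<in> {v. ?P v}" "y \<in> {v. ?P v}"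
      then have xy: "?P x" "?P y" by auto
      have "(\<lambda>t. J t (x + y)) = (\<lambda>t. J t x + J t y)"
        using xy by (simp add: J_add)
      moreover have "R (\<lambda>t. J t x + J t y) = (\<lambda>t. R (\<lambda>t. J t x) t + R (\<lambda>t. J t y) t)"
        by (simp add: R_def fun_eq_iff scaleC_add_right)
      ultimately show "x + y \<in> {v. ?P v}"
        using xy by (simp add: scaleC.span_add sq_fields_add [OF w] U_add R_sqW)
    next
      fix c x assume "x \<in> {v. ?P v}"
      then have x: "?P x" by auto
      have "(\<lambda>t. J t (c *\<^sub>C x)) = (\<lambda>t. c *\<^sub>C J t x)"
        using x by (simp add: J_scaleC)
      moreover have "R (\<lambda>t. c *\<^sub>C J t x) = (\<lambda>t. c *\<^sub>C R (\<lambda>t. J t x) t)"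
        by (simp add: R_def fun_eq_iff scaleC_scaleC mult.commute)
      ultimately show "c *\<^sub>C x \<in> {v. ?P v}"
        using x by (simp add: scaleC.span_scale sq_fields_scaleC [OF w] U_scaleC R_sqW)
    qed
  next
    fix x assume "x \<in> u ` I"
    then obtain n where n: "n \<in> I" "x = u n" by auto
    have "R (\<lambda>t. J t (u n)) = (\<lambda>t. indicator UNIV t *\<^sub>C uu u J n t)"
      by (simp add: R_def uu_def fun_eq_iff)
    then have "U (cls (R (\<lambda>t. J t (u n)))) = u n"
      using U_indicator_uu [of UNIV n] n pvm by (simp add: projection_valued_measure_def)
    then show "?P x"
      using n by (simp add: J_sq_fields scaleC.span_base)
  qed
  then show "(\<lambda>t. J t v) \<in> sq (\<lambda>_. 1)" "U (cls (R (\<lambda>t. J t v))) = v" by auto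
qed

lemma wnorm2_J_diff:
  assumes v: "v \<in> cspan (u ` I)" and g: "g \<in> sq (\<lambda>_. 1)"
  shows "wnorm2 \<mu> (\<lambda>_. 1) (\<lambda>t. J t v - g t) = ennreal ((dist v (U (cls (R g))))\<^sup>2)"
proof -
  have w: "(\<lambda>_. 1::real) \<in> borel_measurable borel" "0 \<le> (1::real)" by simp_all
  have "R (\<lambda>t. J t v - g t) = (\<lambda>t. R (\<lambda>t. J t v) t - R g t)"
    by (simp add: R_def fun_eq_iff scaleC.scale_right_diff_distrib)
  then have "U (cls (R (\<lambda>t. J t v - g t))) = v - U (cls (R g))"
    by (simp add: U_diff R_sqW R_J_span [OF v] g)
  then show ?thesis
    using wnorm2_R [OF sq_fields_diff [OF w R_J_span(1) [OF v] g]]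
    by (simp only: dist_norm)
qed

text \<open>Approximation of \<open>g\<close> by the fields of \<open>v j\<close> means convergence
  of \<open>v\<close> to \<open>U (cls (R g))\<close>, by \<open>wnorm2_J_diff\<close>. Uniqueness
  of limits thus replaces the extension by continuity with an equation.\<close>

lemma Lambda_ext_iff:
  "g \<in> Lambda_ext u I J \<mu> \<xi> \<longleftrightarrow>
    g \<in> sq (\<lambda>_. 1) \<and> \<xi> \<in> closure (cspan (u ` I)) \<and> U (cls (R g)) = \<xi>"
proof
  assume "g \<in> Lambda_ext u I J \<mu> \<xi>"
  then obtain v where g: "g \<in> sq (\<lambda>_. 1)" and v: "range v \<subseteq> cspan (u ` I)" "v \<longlonglongrightarrow> \<xi>"
    and lim: "(\<lambda>j. wnorm2 \<mu> (\<lambda>_. 1) (\<lambda>t. J t (v j) - g t)) \<longlonglongrightarrow> 0"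
    by (auto simp: Lambda_ext_def)
  have "wnorm2 \<mu> (\<lambda>_. 1) (\<lambda>t. J t (v j) - g t) = ennreal ((dist (v j) (U (cls (R g))))\<^sup>2)" for j
    using v(1) by (intro wnorm2_J_diff g) auto
  with lim have "v \<longlonglongrightarrow> U (cls (R g))"
    by (simp only: tendsto_ennreal_dist_iff)
  then have "U (cls (R g)) = \<xi>"
    by (rule LIMSEQ_unique [OF _ v(2)])
  moreover have "\<xi> \<in> closure (cspan (u ` I))"
    using v unfolding closure_sequential by blast
  ultimately show "g \<in> sq (\<lambda>_. 1) \<and> \<xi> \<in> closure (cspan (u ` I)) \<and> U (cls (R g)) = \<xi>"
    using g by simp
next
  assume g: "g \<in> sq (\<lambda>_. 1) \<and> \<xi> \<in> closure (cspan (u ` I)) \<and> U (cls (R g)) = \<xi>"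
  then obtain v where v: "\<And>j. v j \<in> cspan (u ` I)" "v \<longlonglongrightarrow> \<xi>"
    unfolding closure_sequential by blast
  then have "(\<lambda>j. ennreal ((dist (v j) (U (cls (R g))))\<^sup>2)) \<longlonglongrightarrow> 0"
    using g by (simp only: tendsto_ennreal_dist_iff)
  then have "(\<lambda>j. wnorm2 \<mu> (\<lambda>_. 1) (\<lambda>t. J t (v j) - g t)) \<longlonglongrightarrow> 0"
    using g v(1) by (simp only: wnorm2_J_diff)
  then show "g \<in> Lambda_ext u I J \<mu> \<xi>"
    using g v unfolding Lambda_ext_def by blast
qed

text \<open>Take a field with image \<open>\<xi>\<close> under \<open>U\<close> and undo the
  resolvent factor. Without such a \<open>g\<close>, the condition for \<open>\<xi>\<close> in
  \<open>model_Hdot\<close> would be vacuous.\<close>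

lemma Lambda_ext_nonempty:
  assumes "\<xi> \<in> closure (cspan (u ` I))"
  shows "\<exists>g. g \<in> Lambda_ext u I J \<mu> \<xi>"
proof -
  obtain h where h: "h \<in> sqW" "\<xi> = U (cls h)" by (rule U_surj)
  define g where "g = (\<lambda>t. (complex_of_real t - \<i>) *\<^sub>C h t)"
  have "g \<in> sq (\<lambda>_. 1)"
    unfolding g_def
  proof (rule sq_fields_mult [OF h(1) one_plus_square, where K = 1])
    show "1 * (cmod (complex_of_real t - \<i>))\<^sup>2 \<le> 1 * (1 + t\<^sup>2)" for t
      by (simp only: cmod_of_real_minus_i)
  qed simp_all
  moreover have "R g = h"
  proof
    fix t
    have "complex_of_real t - \<i> \<noteq> 0" by (simp add: complex_eq_iff)
    then show "R g t = h t" by (simp add: R_def g_def scaleC_scaleC)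
  qed
  ultimately show ?thesis
    using assms h(2) by (auto simp: Lambda_ext_iff)
qed

text \<open>In the first argument of \<open>cinner\<close> the resolvent factor is conjugated to the
  inverse of \<open>t + \<i>\<close>, which cancels the factor coming from
  \<open>H + \<i>\<close>.\<close>

lemma cinner_U_plus_i:
  assumes g: "g \<in> sq (\<lambda>_. 1)" and f: "f \<in> sqW2"
  shows "cinner (U (cls (R g))) (U (cls (\<lambda>t. complex_of_real t *\<^sub>C f t)) + \<i> *\<^sub>C U (cls f))
    = (LINT t|M. complex_of_real (1 + t\<^sup>2) * cinner (g t) (f t))"
proof -
  have fW: "f \<in> sqW" by (rule sqW2_imp_sqW [OF f])
  have eq: "cinner (R g t) (complex_of_real t *\<^sub>C f t + \<i> *\<^sub>C f t) = cinner (g t) (f t)" for t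
  proof -
    have "complex_of_real t + \<i> \<noteq> 0" by (simp add: complex_eq_iff)
    then show ?thesis
      by (simp add: R_def cinner_scaleC_left scaleC_add_left [symmetric] cinner_scaleC_right)
  qed
  have "U (cls (\<lambda>t. complex_of_real t *\<^sub>C f t)) + \<i> *\<^sub>C U (cls f)
      = U (cls (\<lambda>t. complex_of_real t *\<^sub>C f t + \<i> *\<^sub>C f t))"
    using U_add [OF mult_sqW2 [OF f] sq_fields_scaleC [OF one_plus_square fW, of \<i>]]
    by (simp only: U_scaleC [OF fW])
  also have "cinner (U (cls (R g))) \<dots> = (LINT t|M. complex_of_real (1 + t\<^sup>2)
      * cinner (R g t) (complex_of_real t *\<^sub>C f t + \<i> *\<^sub>C f t))"
    by (intro cinner_U R_sqW g sq_fields_add one_plus_square mult_sqW2 f sq_fields_scaleC fW)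
  finally show ?thesis unfolding eq .
qed

text \<open>By \<open>cinner_U_plus_i\<close> the integral has the same value for every
  representative \<open>g\<close> of the image of \<open>\<xi>\<close>, namely the inner product of
  \<open>\<xi>\<close> with \<open>y + \<i> *\<^sub>C x\<close>.\<close>

lemma conjugate_model_Hdot:
  assumes N: "N = closure (cspan (u ` I))"
  shows "conjugate_op U (model_Hdot N u I J \<mu>)
    = {(x, y) \<in> conjugate_op U (model_H u I J \<mu>). \<forall>\<xi>\<in>N. cinner \<xi> (y + \<i> *\<^sub>C x) = 0}"
proof -
  have iff: "(\<forall>\<xi>\<in>N. \<forall>g\<in>Lambda_ext u I J \<mu> \<xi>.
        (LINT t|M. complex_of_real (1 + t\<^sup>2) * cinner (g t) (f t)) = 0)
      \<longleftrightarrow> (\<forall>\<xi>\<in>N. cinner \<xi> (U (cls (\<lambda>t. complex_of_real t *\<^sub>C f t)) + \<i> *\<^sub>C U (cls f)) = 0)"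
    if f: "f \<in> sqW2" for f
  proof (intro ball_cong refl)
    fix \<xi> assume "\<xi> \<in> N"
    then obtain g where "g \<in> Lambda_ext u I J \<mu> \<xi>"
      using Lambda_ext_nonempty N by blast
    moreover have "(LINT t|M. complex_of_real (1 + t\<^sup>2) * cinner (g t) (f t))
        = cinner \<xi> (U (cls (\<lambda>t. complex_of_real t *\<^sub>C f t)) + \<i> *\<^sub>C U (cls f))"
      if "g \<in> Lambda_ext u I J \<mu> \<xi>" for g
      using that cinner_U_plus_i [OF _ f, of g] by (simp only: Lambda_ext_iff)
    ultimately show "(\<forall>g\<in>Lambda_ext u I J \<mu> \<xi>.
        (LINT t|M. complex_of_real (1 + t\<^sup>2) * cinner (g t) (f t)) = 0)
      \<longleftrightarrow> cinner \<xi> (U (cls (\<lambda>t. complex_of_real t *\<^sub>C f t)) + \<i> *\<^sub>C U (cls f)) = 0"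
      by auto
  qed
  have "conjugate_op U (model_Hdot N u I J \<mu>)
      = {(U (cls f), U (cls (\<lambda>t. complex_of_real t *\<^sub>C f t))) | f. f \<in> sqW2 \<and>
          (\<forall>\<xi>\<in>N. \<forall>g\<in>Lambda_ext u I J \<mu> \<xi>.
            (LINT t|M. complex_of_real (1 + t\<^sup>2) * cinner (g t) (f t)) = 0)}"
    unfolding conjugate_op_def model_Hdot_def by blast
  also have "\<dots> = {(U (cls f), U (cls (\<lambda>t. complex_of_real t *\<^sub>C f t))) | f. f \<in> sqW2 \<and>
      (\<forall>\<xi>\<in>N. cinner \<xi> (U (cls (\<lambda>t. complex_of_real t *\<^sub>C f t)) + \<i> *\<^sub>C U (cls f)) = 0)}"
    by (simp only: iff cong: conj_cong)
  also have "\<dots> = {(x, y) \<in> conjugate_op U (model_H u I J \<mu>).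
      \<forall>\<xi>\<in>N. cinner \<xi> (y + \<i> *\<^sub>C x) = 0}"
    unfolding conjugate_model_H by blast
  finally show ?thesis .
qed

section \<open>The deficiency subspace of the model\<close>

text \<open>A combination of the \<open>uu\<close> fields is \<open>R\<close> applied to the
  \<open>J\<close>-image of the same combination of the \<open>u n\<close>, so \<open>U\<close> maps
  it to that combination.\<close>

lemma wnorm2_diff_uu_sum:
  assumes f: "f \<in> sqW" and S: "finite S" "S \<subseteq> I"
  shows "wnorm2 \<mu> (\<lambda>t. 1 + t\<^sup>2) (\<lambda>t. f t - (\<Sum>n\<in>S. \<beta> n *\<^sub>C uu u J n t))
    = ennreal ((dist (\<Sum>n\<in>S. \<beta> n *\<^sub>C u n) (U (cls f)))\<^sup>2)"
proof -
  let ?v = "\<Sum>n\<in>S. \<beta> n *\<^sub>C u n"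
  have v: "?v \<in> cspan (u ` I)"
    using S by (intro scaleC.span_sum scaleC.span_scale scaleC.span_base) auto
  have eq: "(\<lambda>t. \<Sum>n\<in>S. \<beta> n *\<^sub>C uu u J n t) = R (\<lambda>t. J t ?v)"
    by (simp add: fun_eq_iff R_def uu_def J_sum [OF S] scaleC.scale_sum_right scaleC_scaleC mult.commute)
  have RJ: "R (\<lambda>t. J t ?v) \<in> sqW" by (intro R_sqW R_J_span v)
  have "wnorm2 \<mu> (\<lambda>t. 1 + t\<^sup>2) (\<lambda>t. f t - R (\<lambda>t. J t ?v) t)
      = ennreal ((norm (U (cls f) - ?v))\<^sup>2)"
    unfolding wnorm2_U [OF sq_fields_diff [OF one_plus_square f RJ]] U_diff [OF f RJ]
      R_J_span(2) [OF v] ..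
  then show ?thesis
    unfolding eq [symmetric] by (simp only: dist_norm norm_minus_commute)
qed

text \<open>Through \<open>wnorm2_diff_uu_sum\<close>, approximation by combinations of the
  \<open>uu\<close> fields is approximation by vectors of the span.\<close>

lemma U_image_model_N: "U ` model_N u I J \<mu> = closure (cspan (u ` I))"
proof (intro equalityI subsetI)
  fix x assume "x \<in> U ` model_N u I J \<mu>"
  then obtain f where f: "f \<in> sqW" "x = U (cls f)"
    and approx: "\<And>e. e > 0 \<Longrightarrow> \<exists>S \<beta>. finite S \<and> S \<subseteq> I \<and>
         wnorm2 \<mu> (\<lambda>t. 1 + t\<^sup>2) (\<lambda>t. f t - (\<Sum>n\<in>S. \<beta> n *\<^sub>C uu u J n t)) < e"
    by (auto simp: model_N_def)
  show "x \<in> closure (cspan (u ` I))"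
    unfolding closure_approachable
  proof (intro allI impI)
    fix e :: real assume e: "0 < e"
    then obtain S \<beta> where S: "finite S" "S \<subseteq> I"
      and less: "wnorm2 \<mu> (\<lambda>t. 1 + t\<^sup>2) (\<lambda>t. f t - (\<Sum>n\<in>S. \<beta> n *\<^sub>C uu u J n t)) < ennreal (e\<^sup>2)"
      using approx [of "ennreal (e\<^sup>2)"] by auto
    then have "(dist (\<Sum>n\<in>S. \<beta> n *\<^sub>C u n) x)\<^sup>2 < e\<^sup>2"
      unfolding wnorm2_diff_uu_sum [OF f(1) S] f(2) by (simp add: ennreal_less_iff)
    then have "dist (\<Sum>n\<in>S. \<beta> n *\<^sub>C u n) x < e"
      using e by (intro power2_less_imp_less [of _ e]) auto
    moreover have "(\<Sum>n\<in>S. \<beta> n *\<^sub>C u n) \<in> cspan (u ` I)"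
      using S by (intro scaleC.span_sum scaleC.span_scale scaleC.span_base) auto
    ultimately show "\<exists>y\<in>cspan (u ` I). dist y x < e" by blast
  qed
next
  fix x assume x: "x \<in> closure (cspan (u ` I))"
  obtain f where f: "f \<in> sqW" "x = U (cls f)" by (rule U_surj)
  have "\<exists>S \<beta>. finite S \<and> S \<subseteq> I \<and>
      wnorm2 \<mu> (\<lambda>t. 1 + t\<^sup>2) (\<lambda>t. f t - (\<Sum>n\<in>S. \<beta> n *\<^sub>C uu u J n t)) < e" if e: "e > 0" for e
  proof -
    \<comment> \<open>The bound \<open>e\<close> is extended real and may be infinite; a smaller
      positive \<open>d\<close> is finite. The square root below appears because
      \<open>wnorm2\<close> is a squared norm.\<close>
    obtain d where d: "0 < d" "d < e"
      using dense [OF e] by blast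
    then obtain r where r: "0 < ennreal r" "ennreal r < e"
      by (cases d) auto
    then have r0: "0 < sqrt r" by simp
    then obtain v where v: "v \<in> cspan (u ` I)" "dist v x < sqrt r"
      using x unfolding closure_approachable by blast
    obtain S \<beta> where S: "finite S" "S \<subseteq> I" "v = (\<Sum>n\<in>S. \<beta> n *\<^sub>C u n)"
      using cspan_image_sum [OF v(1)] .
    have "(dist v x)\<^sup>2 < (sqrt r)\<^sup>2"
      using v(2) by (rule power_strict_mono) simp_all
    then have "(dist v x)\<^sup>2 < r"
      using r0 by simp
    then have "wnorm2 \<mu> (\<lambda>t. 1 + t\<^sup>2) (\<lambda>t. f t - (\<Sum>n\<in>S. \<beta> n *\<^sub>C uu u J n t)) < ennreal r"
      unfolding wnorm2_diff_uu_sum [OF f(1) S(1,2)] S(3) f(2) by (simp add: ennreal_less_iff)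
    then show ?thesis using S r(2) less_trans by blast
  qed
  then show "x \<in> U ` model_N u I J \<mu>"
    unfolding model_N_def using f by blast
qed

end

theorem theorem4p6:
  fixes Hdot H :: "('h::{complex_hilbert_space, second_countable_topology} \<times> 'h) set"
    and k :: enat
    and F :: "real \<Rightarrow> 'h \<Rightarrow> 'h"
    and E :: "real set \<Rightarrow> 'h \<Rightarrow> 'h"
    and u :: "nat \<Rightarrow> 'h" and I :: "nat set"
    and \<mu> :: "real measure"
    and \<phi> :: "nat \<Rightarrow> nat \<Rightarrow> real \<Rightarrow> complex"
    and J :: "real \<Rightarrow> 'h \<Rightarrow> 'k::complex_hilbert_space"
    and U :: "(real \<Rightarrow> 'k) set \<Rightarrow> 'h"
  assumes "symmetric_op Hdot" and "densely_defined Hdot" and "closed Hdot" and "prime_op Hdot"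
    and "deficiency_indices Hdot = (k, k)"
    and "self_adjoint_op H" and "Hdot \<subseteq> H"
    and "spectral_family H F"
    and "projection_valued_measure E" and "\<And>t. E {..t} = F t"
    and "complete_orthonormal_system u I (defect_space Hdot \<i>)"
    and "control_measure (defect_space Hdot \<i>) E \<mu>"
    and "density_matrix (defect_space Hdot \<i>) E \<mu> u I \<phi>"
    and "fibre_completions u I \<phi> \<mu> J"
    and "model_unitary E u I J \<mu> U"
  shows "Hdot = conjugate_op U (model_Hdot (defect_space Hdot \<i>) u I J \<mu>)
    \<and> H = conjugate_op U (model_H u I J \<mu>)
    \<and> U ` model_N u I J \<mu> = defect_space Hdot \<i>"
proof -
  have N: "defect_space Hdot \<i> = closure (cspan (u ` I))"
    and orthonormal: "\<And>m n. m \<in> I \<Longrightarrow> n \<in> I \<Longrightarrow> cinner (u m) (u n) = (if m = n then 1 else 0)"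
    using assms(11) by (simp_all add: complete_orthonormal_system_def)
  interpret fibre_model u I J \<mu> E U
  proof (intro fibre_model.intro measurable_fibres.intro fibre_model_axioms.intro)
    show "sets \<mu> = sets borel" "sigma_finite_measure \<mu>"
      using assms(12) by (simp_all add: control_measure_def)
    show "J t (v + w) = J t v + J t w" if "v \<in> cspan (u ` I)" "w \<in> cspan (u ` I)" for t v w
      using assms(14) that by (simp add: fibre_completions_def)
    show "J t (c *\<^sub>C v) = c *\<^sub>C J t v" if "v \<in> cspan (u ` I)" for t c v
      using assms(14) that by (simp add: fibre_completions_def)
    show "integrable (completion \<mu>) (\<lambda>t. cinner (J t (u m)) (J t (u n)))"
      if m: "m \<in> I" and n: "n \<in> I" for m n
    proof -
      \<comment> \<open>By orthonormality each coefficient index set is a singleton, so the double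
        sum reduces to one term.\<close>
      have form: "fibre_form u I \<phi> t (u m) (u n) = \<phi> m n t" for t
      proof -
        have "{k. k \<in> I \<and> cinner (u k) (u l) \<noteq> 0} = {l}" if "l \<in> I" for l
          using orthonormal that by (auto split: if_splits)
        then show ?thesis
          using m n by (simp add: fibre_form_def orthonormal)
      qed
      have "AE t in \<mu>. \<forall>v\<in>cspan (u ` I). \<forall>w\<in>cspan (u ` I).
          cinner (J t v) (J t w) = fibre_form u I \<phi> t v w"
        using assms(14) by (simp add: fibre_completions_def)
      then have "AE t in \<mu>. \<phi> m n t = cinner (J t (u m)) (J t (u n))"
        by eventually_elim (simp add: form m n scaleC.span_base)
      \<comment> \<open>The Gram function is tied to \<open>\<phi> m n\<close> only off a null set,
        so integrability is transferred on the completion.\<close>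
      then have AE: "AE t in completion \<mu>. \<phi> m n t = cinner (J t (u m)) (J t (u n))"
        by (rule AE_completion)
      have "integrable \<mu> (\<phi> m n)"
        using assms(13) m n by (simp add: density_matrix_def)
      then have int: "integrable (completion \<mu>) (\<phi> m n)"
        by (simp add: integrable_completion)
      have "(\<lambda>t. cinner (J t (u m)) (J t (u n))) \<in> borel_measurable (completion \<mu>)"
        by (rule measurable_AE_cong_completion [OF borel_measurable_integrable [OF int] AE]) simp
      then show ?thesis
        using AE by (rule integrable_cong_AE_imp [OF int])
    qed
    show "projection_valued_measure E" "model_unitary E u I J \<mu> U" by fact+
  qed
  have H: "H = conjugate_op U (model_H u I J \<mu>)"
    by (rule self_adjoint_eq_conjugate_model_H) fact+
  have "symmetric_op H"
    using assms(6) by (simp add: self_adjoint_op_def symmetric_op_def)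
  then have "Hdot = {(x, y) \<in> H. \<forall>\<xi>\<in>defect_space Hdot \<i>. cinner \<xi> (y + \<i> *\<^sub>C x) = 0}"
    using closed_symmetric_op_iff_extension [OF assms(1,3) _ assms(7)] by auto
  also have "\<dots> = conjugate_op U (model_Hdot (defect_space Hdot \<i>) u I J \<mu>)"
    unfolding conjugate_model_Hdot [OF N] H [symmetric] ..
  finally show ?thesis
    using H U_image_model_N N by simp
qed

end
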